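(* Let $B$ be a finite set of nonnegative integers with $0\in B$ and $\gcd(B)=1$, and assume that $B$ satisfies the Coven-Meyerowitz property. Let $R$ be the lowest common multiple of the elements of $S_B$. Then there exist finite sets $B',L,L'$ of nonnegative integers such that: (i) $(B,L)$ and $(B',L')$ are complementary Hadamard pairs with scaling factor $R$; (ii) $B'$ satisfies the Coven-Meyerowitz property.
   Context: Coven-Meyerowitz (CM) property: for a finite set $A$ of nonnegative integers let $A(x)=\sum_{a\in A}x^a$. Let $\Phi_s(x)$ denote the $s$-th cyclotomic polynomial and let $S_A$ be the set of all prime powers $s$ (i.e. $s=p^\alpha$, $p$ prime, $\alpha\ge1$) such that $\Phi_s(x)$ divides $A(x)$. $A$ satisfies the Coven-Meyerowitz property if (T1) $A(1)=\prod_{s\in S_A}\Phi_s(1)$, and (T2) if $s_1,\dots,s_m\in S_A$ are powers of distinct primes then $\Phi_{s_1\cdots s_m}(x)$ divides $A(x)$. Hadamard pair: for an integer $R\ge2$ and finite sets $B,L\subset\mathbb{Z}$ with $0\in B$, $0\in L$, $(B,L)$ is a Hadamard pair with scaling factor $R$ if $\#B=\#L=N$ and the matrix $\frac{1}{\sqrt N}\left(e^{2\pi i R^{-1}bl}\right)_{b\in B,l\in L}$ is unitary. Extreme cycles: put $m_B(x)=\frac1N\sum_{b\in B}e^{2\pi i bx}$. A finite set $\{x_0,\dots,x_{r-1}\}\subset\mathbb{R}$ is a cycle for $L$ if there exist $l_0,\dots,l_{r-1}\in L$ with $\frac{x_0+l_0}{R}=x_1,\dots,\frac{x_{r-2}+l_{r-2}}{R}=x_{r-1},\frac{x_{r-1}+l_{r-1}}{R}=x_0$;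 it is extreme for $(B,L)$ if $|m_B(x_k)|=1$ for all $k$. Direct sum: sets $A,A'\subset\mathbb{R}$ have disjoint differences if $(A-A)\cap(A'-A')=\{0\}$; in this case $A\oplus A'=\{a+a':a\in A,a'\in A'\}$ (the sign $\oplus$ asserts disjoint differences). Complementary Hadamard pairs: two Hadamard pairs $(B,L)$, $(B',L')$ with the same scaling factor $R$ (of possibly different sizes) are complementary if (1) $B\oplus B'$ and $L\oplus L'$ are complete sets of representatives modulo $R$; (2) the extreme cycles for $(B,L)$ and the extreme cycles for $(B',L')$ are contained in $\mathbb{Z}$; (3) the greatest common divisor of the elements of $B\oplus B'$ is $1$. *)

theory Defs
  imports
    "HOL-Analysis.Analysis"
    "HOL-Number_Theory.Totient"
    "HOL-Number_Theory.Prime_Powers"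
    "HOL-Computational_Algebra.Computational_Algebra"
begin

section \<open>Cyclotomic polynomials\<close>

text \<open>
  The cyclotomic polynomial is the monic polynomial whose roots are the primitive complex roots
  of unity of order \<open>n\<close>. It has integer coefficients, and divisibility below is taken over
  the integers, so it is defined as the integer polynomial with this image over the complex
  numbers. The lemma \<open>of_int_cyclotomic\<close> shows that this polynomial exists.
\<close>

definition cyclotomic_complex :: "nat \<Rightarrow> complex poly" where
  "cyclotomic_complex n = (\<Prod>k\<in>totatives n. [:- cis (2 * pi * real k / real n), 1:])"

definition cyclotomic :: "nat \<Rightarrow> int poly" where
  "cyclotomic n = (THE p. map_poly of_int p = cyclotomic_complex n)"

lemma map_of_int_add:
  "(map_poly of_int (p + q) :: complex poly) = map_poly of_int p + map_poly of_int q"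
  by (rule poly_eqI) (simp add: coeff_map_poly)

lemma map_of_int_mult:
  "(map_poly of_int (p * q) :: complex poly) = map_poly of_int p * map_poly of_int q"
  by (rule poly_eqI) (simp add: coeff_map_poly coeff_mult)

lemma map_of_int_prod:
  "(map_poly of_int (prod f A) :: complex poly) = (\<Prod>x\<in>A. map_poly of_int (f x))"
  by (induction A rule: infinite_finite_induct) (simp_all add: map_of_int_mult)

lemma map_of_int_inj:
  assumes "(map_poly of_int p :: complex poly) = map_poly of_int q"
  shows "p = q"
proof (rule poly_eqI)
  fix i
  from assms have "coeff (map_poly of_int p :: complex poly) i = coeff (map_poly of_int q) i"
    by simp
  thus "coeff p i = coeff q i" by (simp add: coeff_map_poly)
qed

lemma prod_unity_roots:
  assumes "n > 0"
  shows "(\<Prod>k\<in>{0<..n}. [:- cis (2 * pi * real k / real n), 1:]) = monom 1 n - 1"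
proof -
  let ?p = "monom 1 n - 1 :: complex poly"
  have lc: "degree ?p = n" "lead_coeff ?p = 1"
  proof -
    have "degree ?p = degree (monom (1::complex) n)"
      unfolding diff_conv_add_uminus
      by (rule degree_add_eq_left) (use assms in \<open>simp add: degree_monom_eq\<close>)
    thus d: "degree ?p = n" by (simp add: degree_monom_eq)
    show "lead_coeff ?p = 1" using d assms by simp
  qed
  have "rsquarefree ?p"
    unfolding rsquarefree_roots using assms
    by (auto simp: poly_monom pderiv_diff pderiv_monom power_0_left)
  from complex_poly_decompose_rsquarefree[OF this]
  have "?p = (\<Prod>z | z ^ n = 1. [:-z, 1:])"
    using lc by (simp add: poly_monom)
  also have "\<dots> = (\<Prod>k<n. [:- cis (2 * pi * real k / real n), 1:])"
    by (rule prod.reindex_bij_betw[OF Complex.bij_betw_roots_unity[OF assms], symmetric])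
  also have "\<dots> = (\<Prod>k\<in>{0<..n}. [:- cis (2 * pi * real k / real n), 1:])"
  proof -
    have "{..<n} = insert 0 {0<..<n}" "{0<..n} = insert n {0<..<n}"
      using assms by auto
    thus ?thesis using assms by simp
  qed
  finally show ?thesis ..
qed

lemma prod_cyclotomic_complex:
  assumes "n > 0"
  shows "(\<Prod>d | d dvd n. cyclotomic_complex d) = monom 1 n - 1"
proof -
  let ?f = "\<lambda>k n. [:- cis (2 * pi * real k / real n), 1:]"
  define A where "A = (\<lambda>d. {k\<in>{0<..n}. gcd k n = d})"
  have *: "(\<Prod>k\<in>A d. ?f k n) = cyclotomic_complex (n div d)" if d: "d dvd n" for d
  proof -
    from d assms have "d > 0" by (auto intro: Nat.gr0I)
    have "bij_betw (\<lambda>k. k * d) (totatives (n div d)) (A d)"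
      unfolding A_def using bij_betw_totatives_gcd_eq[OF d assms] by (simp add: mult.commute)
    hence "(\<Prod>k\<in>A d. ?f k n) = (\<Prod>k\<in>totatives (n div d). ?f (k * d) n)"
      by (rule prod.reindex_bij_betw[symmetric])
    also have "\<dots> = cyclotomic_complex (n div d)"
      unfolding cyclotomic_complex_def
      using d \<open>d > 0\<close> by (intro prod.cong refl) (simp add: real_of_nat_div field_simps)
    finally show ?thesis .
  qed
  have "{0<..n} = (\<Union>d\<in>{d. d dvd n}. A d)" by (auto simp: A_def)
  hence "monom 1 n - 1 = (\<Prod>k\<in>(\<Union>d\<in>{d. d dvd n}. A d). ?f k n)"
    using prod_unity_roots[OF assms] by simp
  also have "\<dots> = (\<Prod>d | d dvd n. \<Prod>k\<in>A d. ?f k n)"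
    using assms by (intro prod.UNION_disjoint) (auto simp: A_def)
  also have "\<dots> = (\<Prod>d | d dvd n. cyclotomic_complex (n div d))"
    by (intro prod.cong refl *) auto
  also have "\<dots> = (\<Prod>d | d dvd n. cyclotomic_complex d)" using assms
    by (intro prod.reindex_bij_witness[of _ "(div) n" "(div) n"]) (auto elim: dvdE)
  finally show ?thesis ..
qed

lemma lead_coeff_cyclotomic_complex: "lead_coeff (cyclotomic_complex n) = 1"
  unfolding cyclotomic_complex_def lead_coeff_prod by simp

lemma exists_int_cyclotomic: "\<exists>p. map_poly of_int p = cyclotomic_complex n"
proof (induction n rule: less_induct)
  case (less n)
  show ?case
  proof (cases "n = 0")
    case True
    thus ?thesis by (intro exI[of _ 1]) (simp add: cyclotomic_complex_def)
  next
    case False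
    let ?D = "{d. d dvd n} - {n}"
    have fin: "finite {d. d dvd n}" using False by simp
    have "\<forall>d\<in>?D. \<exists>p. map_poly of_int p = cyclotomic_complex d"
    proof
      fix d assume "d \<in> ?D"
      hence "d < n" using False dvd_imp_le[of d n] by simp
      thus "\<exists>p. map_poly of_int p = cyclotomic_complex d" by (rule less.IH)
    qed
    from bchoice[OF this] obtain F
      where F: "\<And>d. d \<in> ?D \<Longrightarrow> map_poly of_int (F d) = cyclotomic_complex d"
      by blast
    define g where "g = prod F ?D"
    define h where "h = (\<Prod>d\<in>?D. cyclotomic_complex d)"
    have g: "map_poly of_int g = h"
      unfolding g_def h_def map_of_int_prod using F by (intro prod.cong) auto
    have lch: "lead_coeff h = 1"
      unfolding h_def lead_coeff_prod by (simp add: lead_coeff_cyclotomic_complex)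
    have degg: "degree h = degree g"
      unfolding g[symmetric] by (rule degree_map_poly) simp
    have "of_int (lead_coeff g) = (1::complex)"
      using lch unfolding degg by (simp add: g[symmetric] coeff_map_poly)
    hence lcg: "lead_coeff g = 1" by simp
    hence g0: "g \<noteq> 0" by auto
    have hn: "h * cyclotomic_complex n = monom 1 n - 1"
      using prod_cyclotomic_complex[of n] False fin
      by (simp add: h_def prod.remove[of _ n] mult.commute)
    obtain q r where qr: "pseudo_divmod (monom 1 n - 1) g = (q, r)" by fastforce
    from pseudo_divmod[OF g0 qr] lcg
    have eq: "monom 1 n - 1 = g * q + r" and deg: "r = 0 \<or> degree r < degree g"
      by simp_all
    have "map_poly of_int (monom 1 n - 1 :: int poly) = (monom 1 n - 1 :: complex poly)"
      by (rule poly_eqI) (simp add: coeff_map_poly)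
    hence "h * cyclotomic_complex n = h * map_poly of_int q + map_poly of_int r"
      unfolding hn eq map_of_int_add map_of_int_mult g by simp
    hence rr: "map_poly of_int r = h * (cyclotomic_complex n - map_poly of_int q)"
      by (simp add: algebra_simps)
    have degr: "degree (map_poly of_int r :: complex poly) = degree r"
      by (rule degree_map_poly) simp
    have "cyclotomic_complex n - map_poly of_int q = 0"
    proof (rule ccontr)
      assume nz: "\<not> ?thesis"
      have h0: "h \<noteq> 0" using lch by auto
      have "degree r = degree h + degree (cyclotomic_complex n - map_poly of_int q)"
        using degr unfolding rr using degree_mult_eq[OF h0 nz] by simp
      moreover have "r \<noteq> 0" using rr h0 nz by auto
      ultimately show False using deg degg by simp
    qed
    thus ?thesis by (intro exI[of _ q]) simp
  qed
qed

lemma of_int_cyclotomic: "map_poly of_int (cyclotomic n) = cyclotomic_complex n"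
proof -
  have "\<exists>!p. map_poly of_int p = cyclotomic_complex n"
    using exists_int_cyclotomic map_of_int_inj by metis
  thus ?thesis unfolding cyclotomic_def by (rule theI')
qed


section \<open>The Coven--Meyerowitz property\<close>

definition mask_poly :: "nat set \<Rightarrow> int poly" where
  "mask_poly A = (\<Sum>a\<in>A. monom 1 a)"

definition cyclotomic_prime_powers :: "nat set \<Rightarrow> nat set" where
  "cyclotomic_prime_powers A = {s. primepow s \<and> cyclotomic s dvd mask_poly A}"

definition CM_T1 :: "nat set \<Rightarrow> bool" where
  "CM_T1 A \<longleftrightarrow>
     poly (mask_poly A) 1 = (\<Prod>s\<in>cyclotomic_prime_powers A. poly (cyclotomic s) 1)"

text \<open>
  The powers of distinct primes are indexed by their primes. Since 1 is not a prime power, the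
  assumption on \<open>p ^ e p\<close> forces every exponent to be positive.
\<close>

definition CM_T2 :: "nat set \<Rightarrow> bool" where
  "CM_T2 A \<longleftrightarrow>
     (\<forall>P e. finite P \<and> P \<noteq> {} \<and>
        (\<forall>p\<in>P. prime p \<and> p ^ e p \<in> cyclotomic_prime_powers A) \<longrightarrow>
        cyclotomic (\<Prod>p\<in>P. p ^ e p) dvd mask_poly A)"

definition coven_meyerowitz :: "nat set \<Rightarrow> bool" where
  "coven_meyerowitz A \<longleftrightarrow> finite A \<and> CM_T1 A \<and> CM_T2 A"


section \<open>Hadamard pairs\<close>

definition unitary_on :: "'a set \<Rightarrow> 'b set \<Rightarrow> ('a \<Rightarrow> 'b \<Rightarrow> complex) \<Rightarrow> bool" where
  "unitary_on I J U \<longleftrightarrow>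
     (\<forall>i\<in>I. \<forall>i'\<in>I. (\<Sum>j\<in>J. U i j * cnj (U i' j)) = (if i = i' then 1 else 0)) \<and>
     (\<forall>j\<in>J. \<forall>j'\<in>J. (\<Sum>i\<in>I. cnj (U i j) * U i j') = (if j = j' then 1 else 0))"

definition hadamard_pair :: "nat \<Rightarrow> int set \<Rightarrow> int set \<Rightarrow> bool" where
  "hadamard_pair R B L \<longleftrightarrow>
     R \<ge> 2 \<and> finite B \<and> finite L \<and> 0 \<in> B \<and> 0 \<in> L \<and> card B = card L \<and>
     unitary_on B L
       (\<lambda>b l. exp (2 * pi * \<i> * of_int b * of_int l / of_nat R) / sqrt (card B))"


section \<open>Extreme cycles\<close>

definition m_fun :: "int set \<Rightarrow> real \<Rightarrow> complex" where
  "m_fun B x = (\<Sum>b\<in>B. exp (2 * pi * \<i> * of_int b * of_real x)) / of_nat (card B)"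

definition is_cycle :: "nat \<Rightarrow> int set \<Rightarrow> real set \<Rightarrow> bool" where
  "is_cycle R L C \<longleftrightarrow>
     (\<exists>r x l. r \<ge> 1 \<and> C = x ` {..<r} \<and>
        (\<forall>k<r. l k \<in> L \<and> (x k + of_int (l k)) / of_nat R = x (Suc k mod r)))"

definition extreme_cycle :: "nat \<Rightarrow> int set \<Rightarrow> int set \<Rightarrow> real set \<Rightarrow> bool" where
  "extreme_cycle R B L C \<longleftrightarrow> is_cycle R L C \<and> (\<forall>x\<in>C. cmod (m_fun B x) = 1)"


section \<open>Complementary Hadamard pairs\<close>

definition difference_set :: "int set \<Rightarrow> int set" where
  "difference_set A = {a - a' | a a'. a \<in> A \<and> a' \<in> A}"

definition disjoint_differences :: "int set \<Rightarrow> int set \<Rightarrow> bool" where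
  "disjoint_differences A A' \<longleftrightarrow> difference_set A \<inter> difference_set A' = {0}"

definition sumset :: "int set \<Rightarrow> int set \<Rightarrow> int set" where
  "sumset A A' = {a + a' | a a'. a \<in> A \<and> a' \<in> A'}"

definition complete_residues :: "nat \<Rightarrow> int set \<Rightarrow> bool" where
  "complete_residues R C \<longleftrightarrow> (\<forall>n. \<exists>!c. c \<in> C \<and> [c = n] (mod (int R)))"

definition complementary_hadamard_pairs ::
    "nat \<Rightarrow> int set \<Rightarrow> int set \<Rightarrow> int set \<Rightarrow> int set \<Rightarrow> bool" where
  "complementary_hadamard_pairs R B L B' L' \<longleftrightarrow>
     hadamard_pair R B L \<and> hadamard_pair R B' L' \<and>
     disjoint_differences B B' \<and> complete_residues R (sumset B B') \<and>
     disjoint_differences L L' \<and> complete_residues R (sumset L L') \<and>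
     (\<forall>C. extreme_cycle R B L C \<longrightarrow> C \<subseteq> \<int>) \<and>
     (\<forall>C. extreme_cycle R B' L' C \<longrightarrow> C \<subseteq> \<int>) \<and>
     Gcd (sumset B B') = 1"

end

theory Submission
  imports Defs "Jordan_Normal_Form.Determinant"
begin

text \<open>
  Let \<open>T\<close> be the set of prime powers greater than 1 dividing \<open>R\<close>, put \<open>S = S\<^sub>B\<close> and
  \<open>S' = T - S\<close>, and write \<open>p(s)\<close> for the prime dividing \<open>s\<close>. The spectra are
  \<open>L = {\<Sum>s\<in>S. c\<^sub>s R/s | 0 \<le> c\<^sub>s < p(s)}\<close> and \<open>L'\<close>, defined likewise from \<open>S'\<close>. For distinct
  \<open>l, l' \<in> L\<close> the order of \<open>exp (2\<pi>\<i>(l - l')/R)\<close> is a product of members of \<open>S\<close> for distinct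
  primes, so by (T2) the mask of \<open>B\<close> vanishes there; by (T1) the matrix is square, hence unitary.
  As in Coven and Meyerowitz, the mask of \<open>B'\<close> is the product over \<open>p\<^sup>\<alpha> \<in> S'\<close> of
  \<open>1 + y + \<dots> + y\<^sup>p\<^sup>-\<^sup>1\<close> with \<open>y = x ^ (p\<^sup>\<alpha>\<^sup>-\<^sup>1 t)\<close>, where \<open>t\<close> is the part of \<open>R\<close> prime
  to \<open>p\<close>; it vanishes at a root of unity of order \<open>d | R\<close> as soon as the exact power of some
  prime in \<open>d\<close> lies in \<open>S'\<close>. The same square matrix argument, applied to all sums \<open>b + b'\<close> against
  all residues modulo \<open>R\<close>, shows that these sums are pairwise incongruent.

  If \<open>|m\<^sub>B(x)| = 1\<close> then \<open>gcd(B) x\<close> is an integer. All exponents \<open>p\<^sup>\<alpha>\<^sup>-\<^sup>1 t\<close> divide \<open>R\<close>, so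
  \<open>gcd(B') | R\<close>, and a cycle point is \<open>R y - l\<close> with \<open>y\<close> again in the cycle, hence an integer.
\<close>

section \<open>Roots of unity and cyclotomic divisibility\<close>

text \<open>Integer exponents allow conjugates and differences of frequencies to stay within the
  same notation.\<close>

definition unity_exp :: "nat \<Rightarrow> int \<Rightarrow> complex" where
  "unity_exp n j = cis (2 * pi * of_int j / of_nat n)"

lemma unity_exp_0 [simp]: "unity_exp n 0 = 1"
  by (simp add: unity_exp_def)

lemma unity_exp_add: "unity_exp n (i + j) = unity_exp n i * unity_exp n j"
  by (simp add: unity_exp_def cis_mult add_divide_distrib distrib_left)

lemma unity_exp_sum: "finite A \<Longrightarrow> unity_exp n (\<Sum>i\<in>A. f i) = (\<Prod>i\<in>A. unity_exp n (f i))"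
  by (induction A rule: finite_induct) (simp_all add: unity_exp_add)

lemma unity_exp_power: "unity_exp n (int k * j) = unity_exp n j ^ k"
  by (induction k) (simp_all add: unity_exp_add distrib_right)

lemma cnj_unity_exp: "cnj (unity_exp n j) = unity_exp n (- j)"
  by (simp add: unity_exp_def cis_cnj)

lemma cis_2pi_eq_1_iff: "cis (2 * pi * x) = 1 \<longleftrightarrow> x \<in> \<int>"
proof
  assume "cis (2 * pi * x) = 1"
  hence "cos (2 * pi * x) = 1" by (metis cis.simps(1) one_complex.simps(1))
  then obtain k where "2 * pi * x = of_int k * 2 * pi"
    by (auto simp: cos_one_2pi_int)
  hence "x = of_int k" by simp
  thus "x \<in> \<int>" by simp
qed simp

lemma unity_exp_eq_1_iff:
  assumes "n > 0"
  shows "unity_exp n j = 1 \<longleftrightarrow> int n dvd j"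
proof -
  have "unity_exp n j = 1 \<longleftrightarrow> (of_int j / of_int (int n) :: real) \<in> \<int>"
    using cis_2pi_eq_1_iff[of "of_int j / of_nat n"] by (simp add: unity_exp_def)
  also have "\<dots> \<longleftrightarrow> int n dvd j"
    using assms by (subst of_int_div_of_int_in_Ints_iff) auto
  finally show ?thesis .
qed

lemma unity_exp_cancel:
  "g > 0 \<Longrightarrow> unity_exp (g * n) (int g * j) = unity_exp n j"
  by (simp add: unity_exp_def mult.assoc[symmetric])

lemma unity_exp_mod: "n > 0 \<Longrightarrow> unity_exp n (j mod int n) = unity_exp n j"
proof -
  assume n: "n > 0"
  have "unity_exp n (int n * (j div int n) + j mod int n) = unity_exp n (j mod int n)"
    using n unity_exp_eq_1_iff[of n "int n * (j div int n)"] by (simp only: unity_exp_add) simp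
  thus ?thesis by simp
qed

lemma unity_exp_diff: "unity_exp n (i - j) = unity_exp n i * cnj (unity_exp n j)"
  using unity_exp_add[of n i "- j"] by (simp add: cnj_unity_exp)

lemma poly_map_of_int_mask_poly:
  "poly (map_poly of_int (mask_poly A)) z = (\<Sum>a\<in>A. z ^ a :: complex)"
proof -
  have "map_poly of_int (mask_poly A) = (\<Sum>a\<in>A. monom 1 a :: complex poly)"
    unfolding mask_poly_def
    by (induction A rule: infinite_finite_induct) (simp_all add: map_of_int_add map_poly_monom)
  thus ?thesis by (simp add: poly_sum poly_monom)
qed

lemma prod_linear_factors_dvd:
  fixes p :: "'a :: field poly"
  assumes "finite A" "inj_on f A" "\<And>a. a \<in> A \<Longrightarrow> poly p (f a) = 0"
  shows "(\<Prod>a\<in>A. [:- f a, 1:]) dvd p"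
  using assms
proof (induction A rule: finite_induct)
  case (insert a A)
  have "(\<Prod>a\<in>A. [:- f a, 1:]) dvd p" using insert by auto
  then obtain q where q: "p = (\<Prod>a\<in>A. [:- f a, 1:]) * q" by (elim dvdE)
  have "poly (\<Prod>a\<in>A. [:- f a, 1:]) (f a) \<noteq> 0"
    using insert by (auto simp: poly_prod)
  with insert.prems(2)[of a] q have "poly q (f a) = 0" by auto
  hence "[:- f a, 1:] dvd q" by (simp add: poly_eq_0_iff_dvd)
  hence "[:- f a, 1:] * (\<Prod>a\<in>A. [:- f a, 1:]) dvd p"
    unfolding q by (subst (2) mult.commute) (intro mult_dvd_mono dvd_refl)
  thus ?case using insert.hyps by (simp only: prod.insert[OF insert.hyps])
qed simp

text \<open>Division with remainder by a monic \<open>g\<close> stays over the integers. Over the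
  complex numbers \<open>g\<close> divides the remainder, whose degree is smaller, so the remainder
  is 0.\<close>

lemma of_int_monic_dvdD:
  fixes p g :: "int poly"
  assumes "lead_coeff g = 1"
    and "(map_poly of_int g :: complex poly) dvd map_poly of_int p"
  shows "g dvd p"
proof -
  from assms have g0: "g \<noteq> 0" by auto
  obtain q r where qr: "pseudo_divmod p g = (q, r)" by fastforce
  from pseudo_divmod[OF g0 qr] assms(1)
  have eq: "p = g * q + r" and deg: "r = 0 \<or> degree r < degree g" by simp_all
  have "(map_poly of_int g :: complex poly) dvd map_poly of_int r"
    using assms(2) unfolding eq map_of_int_add map_of_int_mult
    by (simp add: dvd_add_right_iff)
  moreover have "degree (map_poly of_int r :: complex poly) = degree r"
    "degree (map_poly of_int g :: complex poly) = degree g"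
    by (rule degree_map_poly; simp)+
  ultimately have "(map_poly of_int r :: complex poly) = 0"
    using deg dvd_imp_degree_le[of "map_poly of_int g :: complex poly" "map_poly of_int r"]
    by (metis linorder_not_le map_poly_0)
  hence "r = 0" using map_of_int_inj[of r 0] by simp
  thus ?thesis using eq by simp
qed

lemma lead_coeff_cyclotomic: "lead_coeff (cyclotomic n) = 1"
proof -
  have "degree (cyclotomic_complex n) = degree (cyclotomic n)"
    unfolding of_int_cyclotomic[symmetric] by (rule degree_map_poly) simp
  hence "of_int (lead_coeff (cyclotomic n)) = lead_coeff (cyclotomic_complex n)"
    by (simp add: of_int_cyclotomic[symmetric] coeff_map_poly)
  thus ?thesis by (simp add: lead_coeff_cyclotomic_complex)
qed

text \<open>The complex roots are the primitive \<open>n\<close>-th roots of unity, all simple, so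
  divisibility can be tested there; it descends to the integers because the divisor is monic. Any
  integer \<open>j\<close> prime to \<open>n\<close> is allowed, not only a totative, since later
  \<open>j\<close> arises as a quotient of arbitrary size and sign.\<close>

lemma cyclotomic_dvd_mask_poly_iff:
  assumes "n > 0"
  shows "cyclotomic n dvd mask_poly A \<longleftrightarrow>
    (\<forall>j. coprime j (int n) \<longrightarrow> (\<Sum>a\<in>A. unity_exp n (int a * j)) = 0)"
proof
  assume "cyclotomic n dvd mask_poly A"
  then obtain q where "mask_poly A = cyclotomic n * q" by (elim dvdE)
  hence q: "map_poly of_int (mask_poly A) = cyclotomic_complex n * map_poly of_int q"
    by (simp add: map_of_int_mult of_int_cyclotomic)
  show "\<forall>j. coprime j (int n) \<longrightarrow> (\<Sum>a\<in>A. unity_exp n (int a * j)) = 0"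
  proof (intro allI impI)
    fix j assume j: "coprime j (int n)"
    \<comment> \<open>For \<open>n = 1\<close> the residue of \<open>j\<close> is 0, whereas
      \<open>totatives 1\<close> is \<open>{1}\<close>.\<close>
    define k where "k = (if n = 1 then 1 else nat (j mod int n))"
    have k: "k \<in> totatives n \<and> unity_exp n (int k) = unity_exp n j"
    proof (cases "n = 1")
      case True
      thus ?thesis by (simp add: k_def unity_exp_def)
    next
      case False
      have ik: "int k = j mod int n" using False assms by (simp add: k_def)
      have "coprime (int k) (int n)" using j ik
        by (metis coprime_mod_left_iff assms of_nat_0_eq_iff less_numeral_extra(3))
      hence cop: "coprime k n" by simp
      have "k \<noteq> 0" using cop False by (intro notI) simp
      moreover have "k < n" using ik assms pos_mod_bound[of "int n" j] by linarith
      ultimately show ?thesis using cop ik unity_exp_mod[OF assms, of j]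
        by (simp add: totatives_def)
    qed
    have "poly (cyclotomic_complex n) (unity_exp n (int k)) = 0"
      using k unfolding cyclotomic_complex_def poly_prod
      by (intro prod_zero) (auto simp: unity_exp_def intro!: bexI[of _ k])
    hence "poly (map_poly of_int (mask_poly A)) (unity_exp n j) = 0"
      using k q by simp
    thus "(\<Sum>a\<in>A. unity_exp n (int a * j)) = 0"
      by (simp add: poly_map_of_int_mask_poly unity_exp_power)
  qed
next
  assume *: "\<forall>j. coprime j (int n) \<longrightarrow> (\<Sum>a\<in>A. unity_exp n (int a * j)) = 0"
  have "cyclotomic_complex n dvd map_poly of_int (mask_poly A)"
    unfolding cyclotomic_complex_def
  proof (rule prod_linear_factors_dvd)
    show "inj_on (\<lambda>k. cis (2 * pi * real k / real n)) (totatives n)"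
    proof (rule inj_onI)
      fix k l assume kl: "k \<in> totatives n" "l \<in> totatives n"
        and "cis (2 * pi * real k / real n) = cis (2 * pi * real l / real n)"
      hence "unity_exp n (int k - int l) = unity_exp n (int l - int l)"
        unfolding unity_exp_diff by (simp add: unity_exp_def)
      hence "int n dvd int k - int l" using unity_exp_eq_1_iff[OF assms] by simp
      moreover have "\<bar>int k - int l\<bar> < int n"
        using kl by (auto simp: totatives_def)
      ultimately show "k = l" using zdvd_not_zless[of "\<bar>int k - int l\<bar>" "int n"]
        by (cases "k = l") auto
    qed
  next
    fix k assume "k \<in> totatives n"
    hence "coprime (int k) (int n)" by (simp add: totatives_def)
    with * have "(\<Sum>a\<in>A. unity_exp n (int a * int k)) = 0" by blast
    thus "poly (map_poly of_int (mask_poly A)) (cis (2 * pi * real k / real n)) = 0"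
      by (simp add: poly_map_of_int_mask_poly unity_exp_power) (simp add: unity_exp_def)
  qed simp
  thus "cyclotomic n dvd mask_poly A"
    by (intro of_int_monic_dvdD) (simp_all add: lead_coeff_cyclotomic of_int_cyclotomic)
qed

text \<open>Comparing the factorizations of \<open>monom 1 (p ^ k) - 1\<close> and
  \<open>monom 1 (p ^ (k - 1)) - 1\<close> leaves the geometric sum of \<open>p\<close> powers of
  \<open>monom 1 (p ^ (k - 1))\<close>, each equal to 1 at 1.\<close>

lemma poly_cyclotomic_primepow_1:
  assumes "prime p" "k > 0"
  shows "poly (cyclotomic (p ^ k)) 1 = int p"
proof -
  define m where "m = p ^ (k - 1)"
  have p0: "p > 0" using assms by (simp add: prime_gt_0_nat)
  hence m0: "m > 0" by (simp add: m_def)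
  have pk: "p ^ k = m * p" using assms by (cases k) (simp_all add: m_def)
  have div: "{d. d dvd p ^ k} = insert (p ^ k) {d. d dvd m}"
  proof -
    have "{..k} = insert k {..k - 1}" using assms by auto
    moreover have "{d. d dvd p ^ k} = (\<lambda>i. p ^ i) ` {..k}" for k
      by (auto simp: divides_primepow_nat[OF assms(1)])
    ultimately show ?thesis by (simp add: m_def)
  qed
  have "\<not> p ^ k dvd m"
    unfolding pk using m0 prime_gt_1_nat[OF assms(1)] by simp
  hence "(\<Prod>d | d dvd p ^ k. cyclotomic_complex d) =
      cyclotomic_complex (p ^ k) * (\<Prod>d | d dvd m. cyclotomic_complex d)"
    unfolding div using m0 by (subst prod.insert) auto
  hence "cyclotomic_complex (p ^ k) * (monom 1 m - 1) = monom 1 (m * p) - 1"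
    using prod_cyclotomic_complex[of m] prod_cyclotomic_complex[of "p ^ k"] m0 p0
    by (simp add: pk)
  also have "\<dots> = (\<Sum>i<p. monom 1 m ^ i) * (monom 1 m - 1)"
    using power_diff_1_eq[of "monom (1::complex) m" p] 
    by (simp add: monom_power mult.commute)
  finally have "cyclotomic_complex (p ^ k) = (\<Sum>i<p. monom 1 m ^ i)"
  proof (rule mult_right_cancel[THEN iffD1, rotated])
    have "poly (monom 1 m - 1 :: complex poly) 0 \<noteq> poly 0 0" using m0 by (simp add: poly_monom power_0_left)
    thus "monom 1 m - 1 \<noteq> (0 :: complex poly)" by metis
  qed
  hence "poly (map_poly of_int (cyclotomic (p ^ k))) (of_int 1) = (of_nat p :: complex)"
    by (simp add: of_int_cyclotomic poly_sum poly_monom)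
  moreover have "poly (map_poly of_int q) (of_int x) = (of_int (poly q x) :: complex)" for q x
    by (simp add: poly_altdef coeff_map_poly degree_map_poly)
  ultimately have "(of_int (poly (cyclotomic (p ^ k)) 1) :: complex) = of_int (int p)"
    by (metis of_int_of_nat_eq)
  thus ?thesis by (simp only: of_int_eq_iff)
qed

lemma poly_cyclotomic_1:
  "primepow s \<Longrightarrow> poly (cyclotomic s) 1 = int (aprimedivisor s)"
  by (auto simp: primepow_def poly_cyclotomic_primepow_1 aprimedivisor_prime_power)

lemma poly_mask_poly_1: "poly (mask_poly A) 1 = int (card A)"
  by (simp add: mask_poly_def poly_sum poly_monom)

section \<open>Unitary matrices of roots of unity\<close>

text \<open>Orthonormal columns mean that the conjugate transpose is a left inverse. The matrix is
  square, so it is a right inverse as well, which is orthonormality of the rows.\<close>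

lemma unitary_onI_columns:
  assumes fin: "finite I" "finite J" and card: "card I = card J"
    and cols: "\<And>j j'. j \<in> J \<Longrightarrow> j' \<in> J \<Longrightarrow>
      (\<Sum>i\<in>I. cnj (U i j) * U i j') = (if j = j' then 1 else 0)"
  shows "unitary_on I J U"
proof -
  define n where "n = card I"
  obtain f where f: "bij_betw f {0..<n} I"
    using ex_bij_betw_nat_finite[OF fin(1)] n_def by auto
  obtain g where g: "bij_betw g {0..<n} J"
    using ex_bij_betw_nat_finite[OF fin(2)] n_def card by auto
  define A where "A = mat n n (\<lambda>(i, j). U (f i) (g j))"
  define A' where "A' = mat n n (\<lambda>(j, i). cnj (U (f i) (g j)))"
  have carrier: "A \<in> carrier_mat n n" "A' \<in> carrier_mat n n"
    by (simp_all add: A_def A'_def)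
  have "A' * A = 1\<^sub>m n"
  proof (rule eq_matI)
    fix i j assume ij: "i < dim_row (1\<^sub>m n :: complex mat)" "j < dim_col (1\<^sub>m n :: complex mat)"
    hence "(A' * A) $$ (i, j) = (\<Sum>k = 0..<n. cnj (U (f k) (g i)) * U (f k) (g j))"
      by (simp add: A_def A'_def scalar_prod_def)
    also have "\<dots> = (\<Sum>k\<in>I. cnj (U k (g i)) * U k (g j))"
      by (rule sum.reindex_bij_betw[OF f])
    also have "\<dots> = (if g i = g j then 1 else 0)"
      using ij g by (intro cols) (auto simp: bij_betw_def)
    also have "\<dots> = 1\<^sub>m n $$ (i, j)"
      using ij g by (auto simp: bij_betw_def inj_on_def)
    finally show "(A' * A) $$ (i, j) = 1\<^sub>m n $$ (i, j)" .
  qed (simp_all add: A_def A'_def)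
  hence AA': "A * A' = 1\<^sub>m n"
    by (rule mat_mult_left_right_inverse[OF carrier(2,1)])
  have rows: "(\<Sum>j\<in>J. U i j * cnj (U i' j)) = (if i = i' then 1 else 0)"
    if ii': "i \<in> I" "i' \<in> I" for i i'
  proof -
    from ii' f obtain k k' where k: "k < n" "k' < n" "i = f k" "i' = f k'"
      by (auto simp: bij_betw_def)
    have "(\<Sum>j\<in>J. U i j * cnj (U i' j)) = (\<Sum>j = 0..<n. U i (g j) * cnj (U i' (g j)))"
      by (rule sum.reindex_bij_betw[OF g, symmetric])
    also have "\<dots> = (A * A') $$ (k, k')"
      using k by (simp add: A_def A'_def scalar_prod_def)
    also have "\<dots> = (if i = i' then 1 else 0)"
      using k f by (auto simp: AA' bij_betw_def inj_on_def)
    finally show ?thesis .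
  qed
  show ?thesis unfolding unitary_on_def using rows cols by blast
qed

text \<open>Rows and columns are indexed abstractly and \<open>\<beta>\<close> is not assumed
  injective: in the main application its injectivity modulo \<open>R\<close> is a consequence of
  unitarity.\<close>

lemma unitary_on_unity_exp:
  assumes fin: "finite I" "finite J" and card: "card I = card J" and ne: "I \<noteq> {}"
    and orth: "\<And>j j'. j \<in> J \<Longrightarrow> j' \<in> J \<Longrightarrow> j \<noteq> j' \<Longrightarrow>
      (\<Sum>i\<in>I. unity_exp R (\<beta> i * (\<mu> j - \<mu> j'))) = 0"
  shows "unitary_on I J (\<lambda>i j. unity_exp R (\<beta> i * \<mu> j) / sqrt (card I))"
proof (rule unitary_onI_columns[OF fin card])
  fix j j' assume j: "j \<in> J" "j' \<in> J"
  have N: "card I > 0" using fin ne by (simp add: card_gt_0_iff)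
  have sq: "complex_of_real (sqrt (card I)) * sqrt (card I) = of_nat (card I)"
    by (simp flip: of_real_mult)
  have "(\<Sum>i\<in>I. cnj (unity_exp R (\<beta> i * \<mu> j) / sqrt (card I)) *
      (unity_exp R (\<beta> i * \<mu> j') / sqrt (card I))) =
      (\<Sum>i\<in>I. unity_exp R (\<beta> i * (\<mu> j' - \<mu> j))) / of_nat (card I)"
    by (simp add: sum_divide_distrib right_diff_distrib unity_exp_diff sq mult.commute)
  also have "\<dots> = (if j = j' then 1 else 0)"
    using N orth[of j' j] j by auto
  finally show "(\<Sum>i\<in>I. cnj (unity_exp R (\<beta> i * \<mu> j) / sqrt (card I)) *
      (unity_exp R (\<beta> i * \<mu> j') / sqrt (card I))) = (if j = j' then 1 else 0)" .
qed

text \<open>Congruent values of \<open>\<beta>\<close> produce identical rows, but distinct rows of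
  a unitary matrix are orthogonal while each row has norm 1.\<close>

lemma unitary_on_unity_exp_rows_incongruent:
  assumes U: "unitary_on I J (\<lambda>i j. unity_exp R (\<beta> i * \<mu> j) / sqrt (card I))"
    and fin: "finite I" and J: "card I = card J" and R: "R > 0"
    and i: "i \<in> I" "i' \<in> I" "int R dvd \<beta> i - \<beta> i'"
  shows "i = i'"
proof (rule ccontr)
  assume ne: "i \<noteq> i'"
  have N: "card I > 0" using fin i by (auto simp: card_gt_0_iff)
  have eq: "unity_exp R (\<beta> i * y) = unity_exp R (\<beta> i' * y)" for y
  proof -
    have "unity_exp R ((\<beta> i - \<beta> i') * y + \<beta> i' * y) = unity_exp R (\<beta> i' * y)"
      using R i(3) unity_exp_eq_1_iff[of R "(\<beta> i - \<beta> i') * y"] by (simp only: unity_exp_add) simp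
    thus ?thesis by (simp add: algebra_simps)
  qed
  have "(\<Sum>j\<in>J. unity_exp R (\<beta> i * \<mu> j) / sqrt (card I) *
      cnj (unity_exp R (\<beta> i' * \<mu> j) / sqrt (card I))) = (if i = i' then 1 else 0)"
    using U i unfolding unitary_on_def by blast
  also have "\<dots> = (if i = i then 1 else 0) - 1" using ne by simp
  also have "\<dots> = (\<Sum>j\<in>J. unity_exp R (\<beta> i * \<mu> j) / sqrt (card I) *
      cnj (unity_exp R (\<beta> i * \<mu> j) / sqrt (card I))) - 1"
    using U i unfolding unitary_on_def by auto
  finally show False by (simp add: eq)
qed

section \<open>Orders of digit differences\<close>

lemma primepowE_aprimedivisor:
  assumes "primepow s"
  obtains p m where "prime p" "m > 0" "s = p ^ m" "aprimedivisor s = p"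
  using assms aprimedivisor_prime_power unfolding primepow_def by metis

text \<open>The part of \<open>d\<close> prime to \<open>p\<close> divides \<open>t\<close>, so both
  conditions only concern the exponent of \<open>p\<close> in \<open>d\<close>: the first bounds it
  by \<open>m\<close>, the second excludes \<open>m - 1\<close> and below.\<close>

lemma multiplicity_eqI_dvd:
  fixes d p t m :: nat
  assumes p: "prime p" "coprime p t" and m: "m > 0"
    and d: "d dvd p ^ m * t" "\<not> d dvd p ^ (m - 1) * t"
  shows "multiplicity p d = m"
proof -
  have d0: "d \<noteq> 0" using d p by (metis dvd_0_left_iff dvd_0_right mult_is_0 power_eq_0_iff not_prime_0 coprime_0_right_iff not_prime_unit)
  obtain u where u: "d = p ^ multiplicity p d * u" "coprime p u"
    using d0 p by (metis multiplicity_decompose' prime_imp_coprime not_prime_unit not_dvd_imp_multiplicity_0)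
  have "coprime u (p ^ m)" using u(2) by (simp add: coprime_commute)
  hence ut: "u dvd t" using u d(1) by (metis coprime_dvd_mult_right_iff dvd_mult_right)
  have "coprime (p ^ multiplicity p d) t" using p by simp
  hence "p ^ multiplicity p d dvd p ^ m"
    using u d(1) by (metis coprime_dvd_mult_left_iff dvd_mult_left)
  hence le: "multiplicity p d \<le> m"
    using p by (simp add: power_dvd_iff_le_multiplicity prime_gt_1_nat dvd_power_iff_le prime_ge_2_nat)
  have "\<not> multiplicity p d \<le> m - 1"
  proof
    assume "multiplicity p d \<le> m - 1"
    hence "d dvd p ^ (m - 1) * t"
      using ut by (subst u(1)) (intro mult_dvd_mono le_imp_power_dvd)
    thus False using d by simp
  qed
  with le m show ?thesis by simp
qed

text \<open>Converse of the preceding criterion, by the same splitting of \<open>d\<close> into a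
  power of \<open>p\<close> and a part dividing \<open>t\<close>.\<close>

lemma multiplicity_dvd_cases:
  fixes d p t k :: nat
  assumes p: "prime p" "coprime p t" and d: "d dvd p ^ k * t" and t: "t > 0"
    and m: "m = multiplicity p d" "m > 0"
  shows "d dvd p ^ m * t" "\<not> d dvd p ^ (m - 1) * t"
proof -
  have d0: "d \<noteq> 0" using m by (intro notI) simp
  obtain u where u: "d = p ^ m * u" "coprime p u"
    using d0 p m by (metis multiplicity_decompose' prime_imp_coprime not_prime_unit not_dvd_imp_multiplicity_0)
  have "coprime u (p ^ k)" using u(2) by (simp add: coprime_commute)
  hence "u dvd t" using u d by (metis coprime_dvd_mult_right_iff dvd_mult_right)
  thus "d dvd p ^ m * t" using u by simp
  show "\<not> d dvd p ^ (m - 1) * t"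
  proof
    assume "d dvd p ^ (m - 1) * t"
    moreover have "coprime (p ^ m) t" using p by simp
    ultimately have "p ^ m dvd p ^ (m - 1)" using u
      by (metis coprime_dvd_mult_left_iff dvd_mult_left)
    thus False using p m by (simp add: dvd_power_iff_le prime_ge_2_nat)
  qed
qed

lemma prime_power_cofactor:
  fixes R p :: nat
  assumes "R > 0" "prime p"
  obtains k t where "R = p ^ k * t" "coprime p t" "t > 0"
    "k = multiplicity p R" "t = R div p ^ multiplicity p R"
proof -
  have "R = p ^ multiplicity p R * (R div p ^ multiplicity p R)"
    by (simp add: multiplicity_dvd)
  moreover from this have "R div p ^ multiplicity p R > 0" using assms
    by (metis gr0I mult_0_right)
  moreover have "coprime p (R div p ^ multiplicity p R)"
    using assms by (intro prime_imp_coprime multiplicity_decompose) auto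
  ultimately show ?thesis using that by blast
qed

text \<open>
  For \<open>T = S\<^sub>B\<close> and \<open>I = B\<close> this is (T2), evaluated at the roots of unity of order dividing \<open>R\<close>.
\<close>

definition vanishing :: "nat \<Rightarrow> nat set \<Rightarrow> 'a set \<Rightarrow> ('a \<Rightarrow> int) \<Rightarrow> bool" where
  "vanishing R T I \<beta> \<longleftrightarrow>
     (\<forall>d j. d dvd R \<and> d > 1 \<and> coprime j (int d) \<and>
        (\<forall>p. prime p \<and> p dvd d \<longrightarrow> p ^ multiplicity p d \<in> T) \<longrightarrow>
        (\<Sum>i\<in>I. unity_exp d (\<beta> i * j)) = 0)"

lemma dvd_mult_div_dvd:
  assumes "s dvd n" "s dvd R"
  shows "int R dvd int n * int (R div s)"
proof -
  have "R dvd n * (R div s)" using assms by (auto elim!: dvdE)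
  thus ?thesis by (metis of_nat_dvd_iff of_nat_mult)
qed

text \<open>The sum divided by \<open>R\<close> is the sum of the fractions
  \<open>\<delta> s / s\<close>, and \<open>d\<close> is its reduced denominator. Among the powers
  of a prime \<open>p\<close>, the largest \<open>s\<close> with
  \<open>\<delta> s \<noteq> 0\<close> is the exact power of \<open>p\<close> in \<open>d\<close>:
  its numerator is smaller than \<open>p\<close> in absolute value, so nothing cancels, and the
  other fractions carry smaller powers of \<open>p\<close>. Hence \<open>d\<close> satisfies the
  condition on orders in \<open>vanishing\<close>.\<close>

lemma digit_difference_reduced:
  fixes \<delta> :: "nat \<Rightarrow> int"
  assumes R: "R > 0" and T: "T \<subseteq> primepow_factors R"
    and \<delta>: "\<And>s. s \<in> T \<Longrightarrow> \<bar>\<delta> s\<bar> < int (aprimedivisor s)"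
    and s0: "s0 \<in> T" "\<delta> s0 \<noteq> 0"
  obtains d j where "d dvd R" "d > 1" "coprime j (int d)"
    "\<And>p. prime p \<Longrightarrow> p dvd d \<Longrightarrow> p ^ multiplicity p d \<in> T"
    "\<And>y. unity_exp R (y * (\<Sum>s\<in>T. \<delta> s * int (R div s))) = unity_exp d (y * j)"
proof -
  define x where "x = (\<Sum>s\<in>T. \<delta> s * int (R div s))"
  have finT: "finite T" using T R finite_primepow_factors[of R] by (auto intro: finite_subset)
  \<comment> \<open>Dividing by \<open>g\<close> brings \<open>x / R\<close> to the lowest terms
    \<open>j / d\<close>.\<close>
  define g where "g = nat (gcd (int R) x)"
  have g: "int g = gcd (int R) x" by (simp add: g_def)
  have g0: "g > 0" using R by (simp add: g_def)
  define d where "d = R div g"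
  define j where "j = x div int g"
  have gR: "int g dvd int R" "int g dvd x" by (simp_all add: g)
  hence Rd: "R = g * d" and xj: "x = int g * j"
    by (simp_all add: d_def j_def)
  have cop: "coprime j (int d)"
  proof -
    have "gcd (int g * int d) (int g * j) = int g"
      using g Rd xj by simp
    moreover have "gcd (int g * int d) (int g * j) = int g * gcd (int d) j"
      using gcd_mult_distrib_int[of "int g" "int d" j] by simp
    ultimately have "int g * gcd (int d) j = int g * 1" by linarith
    hence "gcd (int d) j = 1" using g0 by simp
    thus ?thesis by (metis coprime_iff_gcd_eq_1 gcd.commute)
  qed
  \<comment> \<open>This turns divisibility by \<open>d\<close> into divisibility by
    \<open>R\<close> of a multiple of \<open>x\<close>, which can be examined term by term.\<close>
  have char: "d dvd n \<longleftrightarrow> int R dvd int n * x" for n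
  proof -
    have "int R dvd int n * x \<longleftrightarrow> int g * int d dvd int g * (int n * j)"
      by (simp add: Rd xj mult_ac)
    also have "\<dots> \<longleftrightarrow> int d dvd int n * j" using g0 by simp
    also have "\<dots> \<longleftrightarrow> int d dvd int n"
      using cop by (simp add: coprime_dvd_mult_left_iff coprime_commute)
    finally show ?thesis by simp
  qed
  have exp: "unity_exp R (y * x) = unity_exp d (y * j)" for y
  proof -
    have "y * x = int g * (y * j)" by (simp add: xj)
    thus ?thesis using unity_exp_cancel[OF g0, of d "y * j"] by (simp only: Rd)
  qed
  define E where "E = (\<lambda>p. {s \<in> T. aprimedivisor s = p \<and> \<delta> s \<noteq> 0})"
  have other: "s dvd t" if s: "s \<in> T" "aprimedivisor s \<noteq> p" and p: "prime p"
    and t: "R = p ^ k * t" for s p k t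
  proof -
    have "primepow s" "s dvd R" using s T by (auto simp: primepow_factors_def)
    from this(1) obtain q a where q: "prime q" "s = q ^ a" "aprimedivisor s = q"
      by (rule primepowE_aprimedivisor)
    hence "coprime s (p ^ k)" using s p by (simp add: primes_coprime)
    thus "s dvd t" using \<open>s dvd R\<close> t by (simp add: coprime_dvd_mult_right_iff)
  qed
  have step: "p ^ multiplicity p d \<in> T \<and> multiplicity p d > 0"
    if p: "prime p" and Ene: "E p \<noteq> {}" for p
  proof -
    obtain k t where kt: "R = p ^ k * t" "coprime p t"
      using prime_power_cofactor[OF R p] by blast
    have finE: "finite (E p)" using finT by (simp add: E_def)
    define s where "s = Max (E p)"
    have sE: "s \<in> E p" using finE Ene by (simp add: s_def)
    hence sT: "s \<in> T" "aprimedivisor s = p" "\<delta> s \<noteq> 0" "primepow s" "s dvd R"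
      using T by (auto simp: E_def primepow_factors_def)
    obtain m where m: "m > 0" "s = p ^ m"
      using primepowE_aprimedivisor[OF sT(4)] sT(2) by metis
    have less: "s' dvd p ^ (m - 1)" if "s' \<in> E p" "s' \<noteq> s" for s'
    proof -
      have "primepow s'" "aprimedivisor s' = p" using that T by (auto simp: E_def primepow_factors_def)
      then obtain a where a: "s' = p ^ a" using primepowE_aprimedivisor by metis
      have "s' < s" using that finE by (simp add: s_def order.not_eq_order_implies_strict)
      hence "a < m" using a m p by (metis power_less_imp_less_exp prime_gt_1_nat)
      thus ?thesis unfolding a by (intro le_imp_power_dvd) simp
    qed
    \<comment> \<open>The multiplier \<open>p ^ (m - 1) * t\<close> already clears every term except
      that of \<open>s\<close>, so the term of \<open>s\<close> alone decides between
      \<open>m - 1\<close> and \<open>m\<close>.\<close>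
    have rest: "int R dvd int (p ^ (m - 1) * t) * (\<delta> s' * int (R div s'))"
      if s': "s' \<in> T - {s}" for s'
    proof (cases "\<delta> s' = 0")
      case False
      have "s' dvd p ^ (m - 1) * t"
      proof (cases "aprimedivisor s' = p")
        case True
        thus ?thesis using less[of s'] s' False by (simp add: E_def)
      next
        case False
        thus ?thesis using other[of s' p k t] s' p kt by simp
      qed
      moreover have "s' dvd R" using s' T by (auto simp: primepow_factors_def)
      ultimately have "int R dvd int (p ^ (m - 1) * t) * int (R div s')"
        by (rule dvd_mult_div_dvd)
      hence "int R dvd \<delta> s' * (int (p ^ (m - 1) * t) * int (R div s'))" by (rule dvd_mult)
      thus ?thesis by (simp add: mult_ac)
    qed simp
    have split: "int n * x = int n * (\<delta> s * int (R div s)) +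
        (\<Sum>s'\<in>T - {s}. int n * (\<delta> s' * int (R div s')))" for n
      unfolding x_def by (subst sum.remove[OF finT sT(1)]) (simp add: distrib_left sum_distrib_left)
    have sum_dvd: "int R dvd (\<Sum>s'\<in>T - {s}. int (p ^ (m - 1) * t) * (\<delta> s' * int (R div s')))"
      using rest by (rule dvd_sum)
    have pm: "p ^ m = p * p ^ (m - 1)" using m by (cases m) simp_all
    have "d dvd p ^ m * t"
    proof -
      have "int R dvd int (p ^ m * t) * int (R div s)"
        by (rule dvd_mult_div_dvd) (use m sT in auto)
      hence "int R dvd \<delta> s * (int (p ^ m * t) * int (R div s))" by (rule dvd_mult)
      moreover have "int R dvd int p * (\<Sum>s'\<in>T - {s}. int (p ^ (m - 1) * t) * (\<delta> s' * int (R div s')))"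
        using sum_dvd by (rule dvd_mult)
      ultimately show ?thesis
        unfolding char split by (intro dvd_add) (simp_all add: pm sum_distrib_left mult_ac)
    qed
    moreover have "\<not> d dvd p ^ (m - 1) * t"
    proof
      assume "d dvd p ^ (m - 1) * t"
      hence "int R dvd int (p ^ (m - 1) * t) * (\<delta> s * int (R div s))"
        unfolding char split using sum_dvd dvd_add_left_iff by blast
      moreover have "R = p ^ m * (R div s)" using sT m by simp
      ultimately have "int p * (int (p ^ (m - 1)) * int (R div s)) dvd
          (int t * \<delta> s) * (int (p ^ (m - 1)) * int (R div s))"
        by (metis (no_types, opaque_lifting) mult.assoc mult.commute of_nat_mult pm)
      moreover have "int (p ^ (m - 1)) * int (R div s) \<noteq> 0"
        using R sT p by (metis dvd_div_eq_0_iff mult_eq_0_iff of_nat_eq_0_iff power_eq_0_iff less_numeral_extra(3) not_prime_0)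
      \<comment> \<open>After cancellation \<open>p\<close> would have to divide
        \<open>\<delta> s\<close>, which is nonzero and smaller than \<open>p\<close> in absolute
        value.\<close>
      ultimately have "int p dvd int t * \<delta> s" by (subst (asm) dvd_mult_cancel_right) auto
      moreover have "coprime (int p) (int t)" using kt by simp
      ultimately have "int p dvd \<delta> s" by (simp add: coprime_dvd_mult_right_iff)
      thus False using sT(3) \<delta>[OF sT(1)] sT(2) dvd_imp_le_int[of "\<delta> s" "int p"] by simp
    qed
    ultimately have "multiplicity p d = m"
      using p kt m by (intro multiplicity_eqI_dvd[of p t m d])
    thus ?thesis using m sT by simp
  qed
  have d0: "d > 0" using R Rd by (cases d) auto
  have "d > 1"
  proof -
    have "primepow s0" using s0 T by (auto simp: primepow_factors_def)
    then obtain p where p: "prime p" "aprimedivisor s0 = p" by (rule primepowE_aprimedivisor)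
    hence "multiplicity p d > 0" using step[of p] s0 by (auto simp: E_def)
    hence "d \<noteq> 1" by (intro notI) simp
    thus ?thesis using d0 by simp
  qed
  moreover have "p ^ multiplicity p d \<in> T" if p: "prime p" "p dvd d" for p
  proof (cases "E p = {}")
    \<comment> \<open>With no active power of \<open>p\<close>, all active \<open>s\<close> divide
      the part \<open>t\<close> of \<open>R\<close> prime to \<open>p\<close>; then \<open>d\<close>
      divides \<open>t\<close>, contrary to \<open>p dvd d\<close>.\<close>
    case True
    obtain k t where kt: "R = p ^ k * t" "coprime p t"
      using prime_power_cofactor[OF R p(1)] by blast
    have "int R dvd int t * x"
      unfolding x_def sum_distrib_left
    proof (rule dvd_sum)
      fix s assume s: "s \<in> T"
      show "int R dvd int t * (\<delta> s * int (R div s))"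
      proof (cases "\<delta> s = 0")
        case False
        hence "s dvd t" using other[OF s _ p(1) kt(1)] True s by (auto simp: E_def)
        hence "int R dvd int t * int (R div s)"
          using s T by (intro dvd_mult_div_dvd) (auto simp: primepow_factors_def)
        hence "int R dvd \<delta> s * (int t * int (R div s))" by (rule dvd_mult)
        thus ?thesis by (simp add: mult_ac)
      qed simp
    qed
    hence "p dvd t" using char p dvd_trans by blast
    hence False using kt p by (metis coprime_absorb_left not_prime_unit)
    thus ?thesis ..
  next
    case False
    thus ?thesis using step p by blast
  qed
  ultimately show ?thesis
    using that[of d j] Rd cop exp unfolding x_def by simp
qed

abbreviation digits :: "nat set \<Rightarrow> (nat \<Rightarrow> nat) set" where
  "digits S \<equiv> PiE S (\<lambda>s. {..<aprimedivisor s})"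

text \<open>The weights are a parameter: \<open>(div) R\<close> gives the two spectra,
  \<open>cofactor_weight R\<close> gives \<open>B'\<close>.\<close>

definition digit_sum :: "(nat \<Rightarrow> nat) \<Rightarrow> nat set \<Rightarrow> (nat \<Rightarrow> nat) \<Rightarrow> nat" where
  "digit_sum w S c = (\<Sum>s\<in>S. c s * w s)"

lemma aprimedivisor_pos_primepow: "primepow (s :: nat) \<Longrightarrow> aprimedivisor s > 0"
  using primepow_gt_Suc_0[of s] by simp

lemma digit_sum_diff:
  "int (digit_sum w S c) - int (digit_sum w S c') = (\<Sum>s\<in>S. (int (c s) - int (c' s)) * int (w s))"
  by (simp add: digit_sum_def sum_subtractf[symmetric] left_diff_distrib)

lemma digit_sum_difference_reduced:
  assumes R: "R > 0" and T: "T \<subseteq> primepow_factors R"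
    and c: "\<And>s. s \<in> T \<Longrightarrow> c s < aprimedivisor s" "\<And>s. s \<in> T \<Longrightarrow> c' s < aprimedivisor s"
    and s0: "s0 \<in> T" "c s0 \<noteq> c' s0"
  obtains d j where "d dvd R" "d > 1" "coprime j (int d)"
    "\<And>p. prime p \<Longrightarrow> p dvd d \<Longrightarrow> p ^ multiplicity p d \<in> T"
    "\<And>y. unity_exp R (y * (int (digit_sum ((div) R) T c) - int (digit_sum ((div) R) T c'))) =
      unity_exp d (y * j)"
proof -
  have "\<bar>int (c s) - int (c' s)\<bar> < int (aprimedivisor s)" if "s \<in> T" for s
    using c[OF that] by linarith
  moreover have "int (c s0) - int (c' s0) \<noteq> 0" using s0 by simp
  ultimately show ?thesis
    using digit_difference_reduced[OF R T, of "\<lambda>s. int (c s) - int (c' s)" s0] s0(1) that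
    unfolding digit_sum_diff by blast
qed

text \<open>If some digit differed, the difference divided by \<open>R\<close> would have reduced
  denominator \<open>d > 1\<close> and so give a root of unity other than 1, whereas divisibility by
  \<open>R\<close> gives 1.\<close>

lemma digit_sum_incongruent:
  assumes R: "R > 0" and T: "T \<subseteq> primepow_factors R"
    and c: "\<And>s. s \<in> T \<Longrightarrow> c s < aprimedivisor s" "\<And>s. s \<in> T \<Longrightarrow> c' s < aprimedivisor s"
    and dvd: "int R dvd int (digit_sum ((div) R) T c) - int (digit_sum ((div) R) T c')"
    and s: "s \<in> T"
  shows "c s = c' s"
proof (rule ccontr)
  assume "c s \<noteq> c' s"
  from digit_sum_difference_reduced[OF R T c s this] obtain d j
    where d: "d > 1" "coprime j (int d)" and
      "\<And>y. unity_exp R (y * (int (digit_sum ((div) R) T c) - int (digit_sum ((div) R) T c'))) =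
        unity_exp d (y * j)" by metis
  from this(3)[of 1] have "unity_exp d j = 1"
    using dvd unity_exp_eq_1_iff[OF R] by (metis mult_1)
  hence "int d dvd j" using d by (simp add: unity_exp_eq_1_iff)
  hence "is_unit (int d)" by (intro coprime_common_divisor[OF d(2)]) simp_all
  thus False using d(1) by simp
qed

lemma digits_eqI:
  assumes "c \<in> digits T" "c' \<in> digits T" "\<And>s. s \<in> T \<Longrightarrow> c s = c' s"
  shows "c = c'"
  using assms by (rule PiE_ext)

lemma finite_digits: "finite S \<Longrightarrow> finite (digits S)"
  by (intro finite_PiE) auto

lemma card_digits: "finite S \<Longrightarrow> card (digits S) = (\<Prod>s\<in>S. aprimedivisor s)"
  by (simp add: card_PiE)

lemma digit_sum_inj_on:
  assumes R: "R > 0" and T: "T \<subseteq> primepow_factors R"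
  shows "inj_on (\<lambda>c. int (digit_sum ((div) R) T c)) (digits T)"
proof (rule inj_onI)
  fix c c' assume c: "c \<in> digits T" "c' \<in> digits T"
    and eq: "int (digit_sum ((div) R) T c) = int (digit_sum ((div) R) T c')"
  show "c = c'"
  proof (rule digits_eqI[OF c])
    fix s assume "s \<in> T"
    thus "c s = c' s"
      by (rule digit_sum_incongruent[OF R T, rotated 3]) (use c eq in \<open>auto simp: PiE_iff\<close>)
  qed
qed

text \<open>The inner product of two distinct columns is an exponential sum over \<open>I\<close> at
  a root of unity whose order has its exact prime powers in \<open>T\<close>, hence is 0. The
  cardinality condition, which for \<open>B\<close> is (T1), makes the matrix square.\<close>

lemma vanishing_unitary_on:
  assumes R: "R > 0" and T: "T \<subseteq> primepow_factors R"
    and I: "finite I" "I \<noteq> {}" "card I = (\<Prod>s\<in>T. aprimedivisor s)"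
    and van: "vanishing R T I \<beta>"
  shows "unitary_on I (digits T)
    (\<lambda>i c. unity_exp R (\<beta> i * int (digit_sum ((div) R) T c)) / sqrt (card I))"
proof (rule unitary_on_unity_exp)
  have finT: "finite T" using T R finite_primepow_factors[of R] by (auto intro: finite_subset)
  show "finite (digits T)" "card I = card (digits T)"
    using finT I by (simp_all add: finite_digits card_digits)
  fix c c' assume c: "c \<in> digits T" "c' \<in> digits T" "c \<noteq> c'"
  then obtain s where s: "s \<in> T" "c s \<noteq> c' s" using digits_eqI by blast
  have "c s < aprimedivisor s" "c' s < aprimedivisor s" if "s \<in> T" for s
    using c that by (auto simp: PiE_iff)
  from digit_sum_difference_reduced[OF R T this s] obtain d j
    where d: "d dvd R" "d > 1" "coprime j (int d)"
      "\<And>p. prime p \<Longrightarrow> p dvd d \<Longrightarrow> p ^ multiplicity p d \<in> T"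
      and eq: "\<And>y. unity_exp R (y * (int (digit_sum ((div) R) T c) - int (digit_sum ((div) R) T c'))) =
        unity_exp d (y * j)" by metis
  show "(\<Sum>i\<in>I. unity_exp R (\<beta> i * (int (digit_sum ((div) R) T c) - int (digit_sum ((div) R) T c')))) = 0"
    unfolding eq using van d unfolding vanishing_def by blast
qed (use I in auto)

section \<open>The tiling complement\<close>

text \<open>The digits are chosen independently, so the sum factors into one geometric sum for each
  member of \<open>S\<close>.\<close>

lemma sum_unity_exp_digits:
  assumes "finite S"
  shows "(\<Sum>c\<in>digits S. unity_exp d (int (digit_sum w S c) * j)) =
    (\<Prod>s\<in>S. \<Sum>k<aprimedivisor s. unity_exp d (int (w s) * j) ^ k)"
proof -
  have "unity_exp d (int (digit_sum w S c) * j) = (\<Prod>s\<in>S. unity_exp d (int (w s) * j) ^ c s)" for c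
    using assms by (simp add: digit_sum_def sum_distrib_right unity_exp_sum unity_exp_power mult.assoc)
  thus ?thesis using assms by (simp add: prod_sum_PiE)
qed

text \<open>A geometric sum of \<open>p\<close> terms with ratio \<open>z\<close> vanishes exactly
  when \<open>z ^ p = 1\<close> and \<open>z \<noteq> 1\<close>; as \<open>j\<close> is prime to
  \<open>d\<close>, both are divisibility conditions on the weight.\<close>

lemma sum_unity_exp_power_eq_0_iff:
  assumes d: "d > 0" and p: "p > 0" and j: "coprime j (int d)"
  shows "(\<Sum>k<p. unity_exp d (int w * j) ^ k) = 0 \<longleftrightarrow> d dvd p * w \<and> \<not> d dvd w"
proof -
  define z where "z = unity_exp d (int w * j)"
  have one: "unity_exp d (int n * j) = 1 \<longleftrightarrow> d dvd n" for n
    using d j by (simp add: unity_exp_eq_1_iff coprime_dvd_mult_left_iff coprime_commute)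
  have zp: "z ^ p = unity_exp d (int (p * w) * j)"
    by (simp add: z_def unity_exp_power[symmetric] mult.assoc)
  show ?thesis
  proof (cases "z = 1")
    case True
    thus ?thesis using one[of w] p by (simp add: z_def)
  next
    case False
    have "(\<Sum>k<p. z ^ k) = 0 \<longleftrightarrow> z ^ p = 1"
      using False by (simp add: geometric_sum)
    thus ?thesis using one[of w] one[of "p * w"] False zp by (simp add: z_def)
  qed
qed

text \<open>
  For \<open>s = p\<^sup>\<alpha>\<close> this is \<open>p\<^sup>\<alpha>\<^sup>-\<^sup>1\<close> times the part of \<open>R\<close> prime to \<open>p\<close>.
\<close>

definition cofactor_weight :: "nat \<Rightarrow> nat \<Rightarrow> nat" where
  "cofactor_weight R s =
     (let p = aprimedivisor s in s div p * (R div p ^ multiplicity p R))"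

lemma cofactor_weight_prime_power:
  assumes "prime p" "m > 0"
  shows "cofactor_weight R (p ^ m) = p ^ (m - 1) * (R div p ^ multiplicity p R)"
  using assms by (cases m) (simp_all add: cofactor_weight_def aprimedivisor_prime_power prime_gt_0_nat del: power_Suc, simp)

lemma cofactor_weight_dvd:
  assumes R: "R > 0" and s: "s \<in> primepow_factors R"
  shows "cofactor_weight R s dvd R"
proof -
  from s have "primepow s" "s dvd R" by (auto simp: primepow_factors_def)
  from this(1) obtain p m where p: "prime p" "m > 0" "s = p ^ m"
    by (rule primepowE_aprimedivisor)
  obtain k t where kt: "R = p ^ k * t" "k = multiplicity p R" "t = R div p ^ multiplicity p R"
    using prime_power_cofactor[OF R p(1)] by metis
  have "m \<le> k"
    unfolding kt(2) using \<open>s dvd R\<close> R p by (intro multiplicity_geI) (auto simp: prime_nat_iff)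
  hence "p ^ (m - 1) * t dvd R" unfolding kt(1) by (intro mult_dvd_mono le_imp_power_dvd) auto
  moreover have "cofactor_weight R s = p ^ (m - 1) * t"
    using p by (simp add: cofactor_weight_prime_power kt(3))
  ultimately show ?thesis by simp
qed

text \<open>These are the two conditions under which the geometric sum belonging to \<open>s\<close>
  vanishes at the roots of unity of order \<open>d\<close>.\<close>

lemma cofactor_weight_dvd_cases:
  assumes R: "R > 0" and d: "d dvd R" "prime p" "p dvd d"
  defines "s \<equiv> p ^ multiplicity p d"
  shows "d dvd aprimedivisor s * cofactor_weight R s" "\<not> d dvd cofactor_weight R s"
proof -
  obtain k t where kt: "R = p ^ k * t" "coprime p t" "t > 0" "t = R div p ^ multiplicity p R"
    using prime_power_cofactor[OF R d(2)] by metis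
  define m where "m = multiplicity p d"
  have m: "m > 0" using d R unfolding m_def
    by (subst prime_multiplicity_gt_zero_iff) auto
  have "p * p ^ (m - 1) = p ^ m" using m by (cases m) auto
  hence "aprimedivisor s * cofactor_weight R s = p ^ m * t" "cofactor_weight R s = p ^ (m - 1) * t"
    using d(2) m
    by (simp_all add: s_def m_def[symmetric] cofactor_weight_prime_power aprimedivisor_prime_power
        mult.assoc[symmetric] kt(4))
  thus "d dvd aprimedivisor s * cofactor_weight R s" "\<not> d dvd cofactor_weight R s"
    using multiplicity_dvd_cases[OF d(2) kt(2) _ kt(3) m_def m] d(1) kt(1) by metis+
qed

text \<open>The two conditions fix the exponent of the prime of \<open>s\<close> in
  \<open>d\<close>. This exponent is positive, so the prime power \<open>d\<close> is a power of
  that same prime. Since \<open>d\<close> is not assumed to divide \<open>R\<close>, no prime power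
  outside \<open>S\<close> can enter \<open>cyclotomic_prime_powers\<close>.\<close>

lemma primepow_eq_of_cofactor_weight:
  assumes R: "R > 0" and s: "primepow s" and d: "primepow d"
    "d dvd aprimedivisor s * cofactor_weight R s" "\<not> d dvd cofactor_weight R s"
  shows "d = s"
proof -
  from s obtain p m where p: "prime p" "m > 0" "s = p ^ m" "aprimedivisor s = p"
    by (rule primepowE_aprimedivisor)
  obtain k t where kt: "R = p ^ k * t" "coprime p t" "t > 0" "t = R div p ^ multiplicity p R"
    using prime_power_cofactor[OF R p(1)] by metis
  have "p * p ^ (m - 1) = p ^ m" using p by (cases m) auto
  hence eq: "aprimedivisor s * cofactor_weight R s = p ^ m * t" "cofactor_weight R s = p ^ (m - 1) * t"
    using p by (simp_all add: cofactor_weight_prime_power mult.assoc[symmetric] kt(4))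
  have "multiplicity p d = m"
    using multiplicity_eqI_dvd[OF p(1) kt(2) p(2)] d(2,3) eq by metis
  moreover from d(1) obtain q n where q: "prime q" "d = q ^ n" "n > 0"
    using primepowE_aprimedivisor by metis
  ultimately show ?thesis using p
    by (cases "p = q") (auto simp: multiplicity_distinct_prime_power)
qed

text \<open>One vanishing factor annihilates the product, so a single prime of \<open>d\<close>
  suffices, whereas \<open>vanishing\<close> speaks of all of them.\<close>

lemma digits_sum_vanishes:
  assumes R: "R > 0" and S: "S \<subseteq> primepow_factors R"
    and d: "d dvd R" "coprime j (int d)" and p: "prime p" "p dvd d" "p ^ multiplicity p d \<in> S"
  shows "(\<Sum>c\<in>digits S. unity_exp d (int (digit_sum (cofactor_weight R) S c) * j)) = 0"
proof -
  have "finite S" using S R finite_primepow_factors[of R] by (auto intro: finite_subset)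
  moreover have "aprimedivisor (p ^ multiplicity p d) > 0"
    using p S by (auto simp: primepow_factors_def intro: aprimedivisor_pos_primepow)
  moreover have "d > 0" using R d by (simp add: dvd_pos_nat)
  ultimately have "(\<Sum>k<aprimedivisor (p ^ multiplicity p d).
      unity_exp d (int (cofactor_weight R (p ^ multiplicity p d)) * j) ^ k) = 0"
    using cofactor_weight_dvd_cases[OF R d(1) p(1,2)] d(2)
    by (subst sum_unity_exp_power_eq_0_iff) auto
  thus ?thesis
    unfolding sum_unity_exp_digits[OF \<open>finite S\<close>]
    by (intro prod_zero \<open>finite S\<close> bexI[OF _ p(3)])
qed

text \<open>The prime powers attached to the set are exactly \<open>S\<close>. Injectivity makes its
  size the product of the primes, which is (T1); in (T2) any one prime of the product already
  provides a vanishing factor.\<close>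

lemma coven_meyerowitz_digits:
  assumes R: "R > 0" and S: "S \<subseteq> primepow_factors R"
    and inj: "inj_on (digit_sum (cofactor_weight R) S) (digits S)"
  shows "coven_meyerowitz (digit_sum (cofactor_weight R) S ` digits S)"
proof -
  define A where "A = digit_sum (cofactor_weight R) S ` digits S"
  have finS: "finite S" using S R finite_primepow_factors[of R] by (auto intro: finite_subset)
  have sum: "(\<Sum>a\<in>A. unity_exp d (int a * j)) =
      (\<Sum>c\<in>digits S. unity_exp d (int (digit_sum (cofactor_weight R) S c) * j))" for d j
    unfolding A_def by (simp add: sum.reindex[OF inj])
  have dvdI: "cyclotomic d dvd mask_poly A"
    if "d dvd R" "prime p" "p dvd d" "p ^ multiplicity p d \<in> S" for d p
  proof -
    have "d > 0" using R that(1) by (rule dvd_pos_nat)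
    thus ?thesis using digits_sum_vanishes[OF R S] that
      by (simp add: cyclotomic_dvd_mask_poly_iff sum)
  qed
  have cpp: "cyclotomic_prime_powers A = S"
  proof (intro equalityI subsetI)
    fix d assume "d \<in> cyclotomic_prime_powers A"
    hence d: "primepow d" "cyclotomic d dvd mask_poly A"
      by (auto simp: cyclotomic_prime_powers_def)
    have d0: "d > 0" using d by (simp add: primepow_gt_0_nat)
    \<comment> \<open>A single primitive root is enough: the factor that vanishes there determines
      \<open>s\<close>.\<close>
    have "(\<Sum>a\<in>A. unity_exp d (int a * 1)) = 0"
      using d(2) cyclotomic_dvd_mask_poly_iff[OF d0] coprime_1_left by blast
    hence "\<exists>s\<in>S. (\<Sum>k<aprimedivisor s. unity_exp d (int (cofactor_weight R s) * 1) ^ k) = 0"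
      unfolding sum sum_unity_exp_digits[OF finS] using finS by (simp only: prod_zero_iff)
    then obtain s where s: "s \<in> S"
      "(\<Sum>k<aprimedivisor s. unity_exp d (int (cofactor_weight R s) * 1) ^ k) = 0" by blast
    have "primepow s" using s S by (auto simp: primepow_factors_def)
    hence "d = s"
      using s d d0 primepow_eq_of_cofactor_weight[OF R]
        sum_unity_exp_power_eq_0_iff[of d "aprimedivisor s" 1 "cofactor_weight R s"]
      by (simp add: aprimedivisor_pos_primepow del: mult_1_right)
    thus "d \<in> S" using s by simp
  next
    fix s assume s: "s \<in> S"
    hence "primepow s" "s dvd R" using S by (auto simp: primepow_factors_def)
    moreover from this(1) obtain p m where "prime p" "m > 0" "s = p ^ m"
      by (rule primepowE_aprimedivisor)
    ultimately show "s \<in> cyclotomic_prime_powers A"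
      using s dvdI[of s p] by (simp add: cyclotomic_prime_powers_def)
  qed
  have "int (card A) = (\<Prod>s\<in>S. poly (cyclotomic s) 1)"
  proof -
    have "int (card A) = (\<Prod>s\<in>S. int (aprimedivisor s))"
      using finS by (simp add: A_def card_image[OF inj] card_digits)
    also have "\<dots> = (\<Prod>s\<in>S. poly (cyclotomic s) 1)"
      using S by (intro prod.cong) (auto simp: primepow_factors_def poly_cyclotomic_1)
    finally show ?thesis .
  qed
  hence "CM_T1 A" by (simp add: CM_T1_def cpp poly_mask_poly_1)
  moreover have "CM_T2 A"
    unfolding CM_T2_def cpp
  proof (intro allI impI, elim conjE)
    fix P :: "nat set" and e
    assume P: "finite P" "P \<noteq> {}" "\<forall>p\<in>P. prime p \<and> p ^ e p \<in> S"
    obtain p where p: "p \<in> P" using P by blast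
    have mult: "multiplicity p (\<Prod>p\<in>P. p ^ e p) = e p"
      using P p by (subst multiplicity_prod_prime_powers) auto
    have "primepow (p ^ e p)" using P p S by (auto simp: primepow_factors_def)
    \<comment> \<open>A zero exponent would make 1 a prime power.\<close>
    hence "e p \<noteq> 0" by (intro notI) simp
    hence "p dvd p ^ e p" by simp
    also have "p ^ e p dvd (\<Prod>p\<in>P. p ^ e p)" by (rule dvd_prodI[OF P(1) p])
    finally have pd: "p dvd (\<Prod>p\<in>P. p ^ e p)" .
    have "[R = 0] (mod (\<Prod>p\<in>P. p ^ e p))"
    proof (rule coprime_cong_prod_nat)
      show "[R = 0] (mod p ^ e p)" if "p \<in> P" for p
        using P S that by (auto simp: primepow_factors_def cong_0_iff)
      show "coprime (p ^ e p) (q ^ e q)" if "p \<in> P" "q \<in> P" "p \<noteq> q" for p q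
        using P that by (simp add: primes_coprime)
    qed
    hence "(\<Prod>p\<in>P. p ^ e p) dvd R" by (simp add: cong_0_iff)
    thus "cyclotomic (\<Prod>p\<in>P. p ^ e p) dvd mask_poly A"
      using P p pd mult by (intro dvdI[of _ p]) auto
  qed
  ultimately show ?thesis
    using finS by (simp add: coven_meyerowitz_def A_def finite_digits)
qed

text \<open>A prime of multiplicity \<open>k\<close> in \<open>R\<close> has exactly
  \<open>k\<close> powers greater than 1 dividing \<open>R\<close>, and each contributes that prime
  once.\<close>

lemma prod_aprimedivisor_primepow_factors:
  assumes "(R :: nat) > 0"
  shows "(\<Prod>s\<in>primepow_factors R. aprimedivisor s) = R"
proof -
  have "(\<Prod>s\<in>primepow_factors R. aprimedivisor s) =
      prod_mset (image_mset aprimedivisor (mset_set (primepow_factors R)))"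
    by (simp add: prod_unfold_prod_mset)
  also have "\<dots> = R"
    using assms by (simp add: aprimedivisor_primepow_factors_conv_prime_factorization prod_mset_prime_factorization_nat)
  finally show ?thesis .
qed

section \<open>Complementary pairs\<close>

text \<open>The sums give \<open>R\<close> distinct residues and therefore all of them. A common
  difference \<open>a - b = a' - b'\<close> rearranges to the equal sums \<open>a + b'\<close> and
  \<open>b + a'\<close>, so it is 0.\<close>

lemma sumset_complete_residues:
  assumes fin: "finite A" "finite A'" and ne: "A \<noteq> {}" "A' \<noteq> {}" and R: "R > 0"
    and card: "card A * card A' = R"
    and incong: "\<And>a b a' b'. a \<in> A \<Longrightarrow> b \<in> A \<Longrightarrow> a' \<in> A' \<Longrightarrow> b' \<in> A' \<Longrightarrow>
      int R dvd (a + a') - (b + b') \<Longrightarrow> a = b \<and> a' = b'"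
  shows "disjoint_differences A A'" "complete_residues R (sumset A A')"
proof -
  show "disjoint_differences A A'"
    unfolding disjoint_differences_def
  proof (intro equalityI subsetI)
    fix x assume "x \<in> difference_set A \<inter> difference_set A'"
    then obtain a b a' b' where x: "a \<in> A" "b \<in> A" "a' \<in> A'" "b' \<in> A'" "x = a - b" "x = a' - b'"
      by (auto simp: difference_set_def)
    hence "(a + b') - (b + a') = 0" by simp
    hence "a = b" using incong[of a b b' a'] x(1-4) by (metis dvd_0_right)
    thus "x \<in> {0}" using x by simp
  next
    fix x :: int assume "x \<in> {0}"
    thus "x \<in> difference_set A \<inter> difference_set A'"
      using ne by (auto simp: difference_set_def)
  qed
  define \<phi> where "\<phi> = (\<lambda>(a, a'). (a + a') mod int R)"
  have inj: "inj_on \<phi> (A \<times> A')"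
  proof (rule inj_onI)
    fix u v assume uv: "u \<in> A \<times> A'" "v \<in> A \<times> A'" "\<phi> u = \<phi> v"
    hence "int R dvd (fst u + snd u) - (fst v + snd v)"
      by (auto simp: \<phi>_def mod_eq_dvd_iff)
    thus "u = v" using incong[of "fst u" "fst v" "snd u" "snd v"] uv
      by (auto simp: prod_eq_iff)
  qed
  have "\<phi> ` (A \<times> A') = {0..<int R}"
  proof (rule card_subset_eq)
    show "\<phi> ` (A \<times> A') \<subseteq> {0..<int R}" using R by (auto simp: \<phi>_def)
    show "card (\<phi> ` (A \<times> A')) = card {0..<int R}"
      using card by (simp add: card_image[OF inj] card_cartesian_product)
  qed simp
  hence surj: "\<exists>a\<in>A. \<exists>a'\<in>A'. (a + a') mod int R = n mod int R" for n
  proof -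
    have "n mod int R \<in> {0..<int R}" using R by simp
    with \<open>\<phi> ` (A \<times> A') = {0..<int R}\<close> have "n mod int R \<in> \<phi> ` (A \<times> A')" by simp
    thus ?thesis by (force simp: \<phi>_def)
  qed
  show "complete_residues R (sumset A A')"
    unfolding complete_residues_def
  proof (intro allI ex_ex1I)
    fix n show "\<exists>c. c \<in> sumset A A' \<and> [c = n] (mod int R)"
      using surj[of n] by (auto simp: sumset_def cong_def)
  next
    fix n c c' assume "c \<in> sumset A A' \<and> [c = n] (mod int R)" "c' \<in> sumset A A' \<and> [c' = n] (mod int R)"
    then obtain a a' b b' where ab: "a \<in> A" "a' \<in> A'" "c = a + a'" "b \<in> A" "b' \<in> A'" "c' = b + b'"
      and "[c = c'] (mod int R)"
      by (auto simp: sumset_def cong_def)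
    hence "int R dvd (a + a') - (b + b')" by (simp add: cong_iff_dvd_diff)
    thus "c = c'" using incong[of a b a' b'] ab by simp
  qed
qed

lemma unitary_on_image:
  assumes "inj_on f I" "inj_on g J" "unitary_on I J (\<lambda>i j. V (f i) (g j))"
  shows "unitary_on (f ` I) (g ` J) V"
  using assms unfolding unitary_on_def
  by (simp add: sum.reindex inj_on_eq_iff)

lemma unity_exp_conv_exp:
  "unity_exp R (b * l) = exp (2 * pi * \<i> * of_int b * of_int l / of_nat R)"
  unfolding unity_exp_def cis_conv_exp by (simp add: mult_ac)

lemma hadamard_pairI:
  assumes "R \<ge> 2" "finite I" "finite J" "card I = card J" "inj_on f I" "inj_on g J"
    and "0 \<in> f ` I" "0 \<in> g ` J"
    and "unitary_on I J (\<lambda>i j. unity_exp R (f i * g j) / sqrt (card I))"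
  shows "hadamard_pair R (f ` I) (g ` J)"
  unfolding hadamard_pair_def
  using assms unitary_on_image[of f I g J
      "\<lambda>b l. exp (2 * pi * \<i> * of_int b * of_int l / of_nat R) / sqrt (card (f ` I))"]
  by (simp add: card_image unity_exp_conv_exp)

section \<open>Extreme cycles\<close>

text \<open>Equality case of the triangle inequality: with \<open>u\<close> the mean, the numbers
  \<open>Re (z c * cnj u)\<close> are at most 1 and average to 1, so all equal 1.\<close>

lemma norm_sum_unit_eq_card:
  fixes z :: "'a \<Rightarrow> complex"
  assumes fin: "finite A" and z: "\<And>a. a \<in> A \<Longrightarrow> cmod (z a) = 1"
    and norm: "cmod (\<Sum>a\<in>A. z a) = real (card A)" and ab: "a \<in> A" "b \<in> A"
  shows "z a = z b"
proof -
  define S where "S = (\<Sum>a\<in>A. z a)"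
  have N: "card A > 0" using fin ab by (auto simp: card_gt_0_iff)
  define u where "u = S / of_nat (card A)"
  have u: "cmod u = 1" using norm N by (simp add: u_def S_def norm_divide)
  have uc: "u * cnj u = 1" using u by (simp add: complex_norm_square[symmetric])
  have le: "Re (z c * cnj u) \<le> 1" if "c \<in> A" for c
    using complex_Re_le_cmod[of "z c * cnj u"] z[OF that] u by (simp add: norm_mult)
  have "(\<Sum>c\<in>A. z c * cnj u) = of_nat (card A) * (u * cnj u)"
    using N unfolding sum_distrib_right[symmetric] S_def[symmetric] by (simp add: u_def)
  hence "(\<Sum>c\<in>A. Re (z c * cnj u)) = real (card A)"
    by (metis Re_sum Re_complex_of_real mult_1_right of_real_of_nat_eq uc)
  hence "(\<Sum>c\<in>A. 1 - Re (z c * cnj u)) = 0" by (simp add: sum_subtractf)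
  hence "\<forall>c\<in>A. 1 - Re (z c * cnj u) = 0"
    using le fin by (subst (asm) sum_nonneg_eq_0_iff) auto
  hence re: "Re (z c * cnj u) = 1" if "c \<in> A" for c using that by auto
  have "z c * cnj u = 1" if "c \<in> A" for c
  proof -
    have "cmod (z c * cnj u) = 1" using z[OF that] u by (simp add: norm_mult)
    hence "Im (z c * cnj u) = 0" using re[OF that] by (simp add: cmod_def)
    thus ?thesis using re[OF that] by (simp add: complex_eq_iff)
  qed
  hence "z c = u" if "c \<in> A" for c
    using that uc by (metis mult.assoc mult.commute mult_1_left)
  thus ?thesis using ab by simp
qed

text \<open>All terms of the sum must coincide, and the term of \<open>0\<close> is 1.\<close>

lemma norm_m_fun_eq_1_imp_Ints:
  assumes fin: "finite B" and B: "0 \<in> B" "b \<in> B" and m: "cmod (m_fun B x) = 1"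
  shows "of_int b * x \<in> \<int>"
proof -
  define z where "z = (\<lambda>b. exp (2 * pi * \<i> * of_int b * of_real x))"
  have zcis: "z b = cis (2 * pi * (of_int b * x))" for b
    by (simp add: z_def cis_conv_exp mult_ac)
  have N: "card B > 0" using fin B by (auto simp: card_gt_0_iff)
  have "cmod (\<Sum>b\<in>B. z b) = real (card B)"
    using m N by (simp add: m_fun_def z_def norm_divide)
  hence "z b = z 0" using B fin by (intro norm_sum_unit_eq_card) (simp_all add: zcis)
  thus ?thesis by (simp add: zcis cis_2pi_eq_1_iff)
qed

lemma Gcd_mult_Ints:
  assumes "finite B" "\<And>b. b \<in> B \<Longrightarrow> real b * x \<in> \<int>"
  shows "real (Gcd B) * x \<in> \<int>"
  using assms
proof (induction B rule: finite_induct)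
  case (insert b B)
  obtain u v where "u * int b + v * int (Gcd B) = gcd (int b) (int (Gcd B))"
    using bezout_int by blast
  hence "real (gcd b (Gcd B)) = of_int u * real b + of_int v * real (Gcd B)"
    by (metis gcd_int_int_eq of_int_add of_int_mult of_int_of_nat_eq)
  hence "real (gcd b (Gcd B)) * x = of_int u * (real b * x) + of_int v * (real (Gcd B) * x)"
    by (simp add: algebra_simps)
  also have "\<dots> \<in> \<int>" using insert by (intro Ints_add Ints_mult[OF Ints_of_int]) auto
  finally show ?case by simp
qed simp

lemma extreme_cycle_Gcd_mult_Ints:
  assumes "finite B" "0 \<in> B" "extreme_cycle R (int ` B) L C" "x \<in> C"
  shows "real (Gcd B) * x \<in> \<int>"
proof (rule Gcd_mult_Ints)
  fix b assume "b \<in> B"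
  thus "real b * x \<in> \<int>"
    using assms norm_m_fun_eq_1_imp_Ints[of "int ` B" "int b" x]
    by (force simp: extreme_cycle_def)
qed (use assms in auto)

lemma is_cycle_succ:
  assumes "is_cycle R L C" "x \<in> C" "R > 0"
  obtains y l where "y \<in> C" "l \<in> L" "x = real R * y - of_int l"
proof -
  from assms obtain r f l where r: "r \<ge> 1" "C = f ` {..<r}"
    and step: "\<forall>k<r. l k \<in> L \<and> (f k + of_int (l k)) / real R = f (Suc k mod r)"
    unfolding is_cycle_def by blast
  obtain k where k: "k < r" "x = f k" using assms(2) r by auto
  have "(f k + of_int (l k)) / real R = f (Suc k mod r)" "l k \<in> L"
    using step k by auto
  moreover have "f (Suc k mod r) \<in> C" using r by simp
  ultimately show ?thesis using that[of "f (Suc k mod r)" "l k"] k assms(3)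
    by (simp add: field_simps)
qed

text \<open>The gcd is applied to the successor \<open>y\<close>, which occurs multiplied by
  \<open>R\<close>; this is why \<open>Gcd B dvd R\<close> suffices in place of
  \<open>Gcd B = 1\<close>.\<close>

lemma extreme_cycle_Ints:
  assumes "finite B" "0 \<in> B" "Gcd B dvd R" "R > 0" "extreme_cycle R (int ` B) L C"
  shows "C \<subseteq> \<int>"
proof
  fix x assume "x \<in> C"
  then obtain y l where y: "y \<in> C" "x = real R * y - of_int l"
    using is_cycle_succ[of R L C x] assms unfolding extreme_cycle_def by metis
  obtain h where "R = Gcd B * h" using assms by (elim dvdE)
  hence "x = real h * (real (Gcd B) * y) - of_int l" using y by simp
  also have "\<dots> \<in> \<int>"
    using extreme_cycle_Gcd_mult_Ints[OF assms(1,2,5) y(1)]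
    by (intro Ints_diff[OF Ints_mult[OF Ints_of_nat]]) auto
  finally show "x \<in> \<int>" .
qed

text \<open>With 0 as the only digit, each step divides by \<open>R \<ge> 2\<close>, so the largest
  absolute value on the cycle must be 0. This serves the case \<open>B' = {0}\<close>, whose gcd 0
  does not divide \<open>R\<close>.\<close>

lemma is_cycle_zero:
  assumes "is_cycle R {0} C" "R \<ge> 2"
  shows "C \<subseteq> {0}"
proof (cases "C = {}")
  case False
  have fin: "finite C" using assms by (auto simp: is_cycle_def)
  define M where "M = Max (abs ` C)"
  have "M \<in> abs ` C" unfolding M_def using fin False by (intro Max_in) auto
  then obtain x where x: "x \<in> C" "M = \<bar>x\<bar>" by blast
  have M: "\<bar>y\<bar> \<le> M" if "y \<in> C" for y unfolding M_def using fin that by (intro Max_ge) auto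
  have bound: "real R * \<bar>y\<bar> \<le> M" if y: "y \<in> C" for y
    using assms y
  proof -
    from assms(1) obtain r f l where r: "r \<ge> 1" "C = f ` {..<r}"
      and step: "\<forall>k<r. l k \<in> {0} \<and> (f k + of_int (l k)) / real R = f (Suc k mod r)"
      unfolding is_cycle_def by blast
    obtain k where k: "k < r" "y = f k" using y r by auto
    \<comment> \<open>The cyclic predecessor of \<open>k\<close>; adding \<open>r - 1\<close> avoids
      subtraction at \<open>k = 0\<close>.\<close>
    define j where "j = (k + (r - 1)) mod r"
    have j: "j < r" "Suc j mod r = k"
      using k r by (simp_all add: j_def mod_Suc_eq)
    hence "f j / real R = y" using step k by auto
    hence "real R * y = f j" using assms(2) by auto
    thus ?thesis using M[of "f j"] r j by (auto simp: abs_mult)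
  qed
  show ?thesis
  proof
    fix y assume "y \<in> C"
    have "2 * M \<le> real R * M" using assms(2) x by (intro mult_right_mono) auto
    hence "M \<le> 0" using bound[OF x(1)] x by simp
    thus "y \<in> {0}" using M[OF \<open>y \<in> C\<close>] by simp
  qed
qed simp

section \<open>Existence of the complementary pair\<close>

lemma zero_in_digit_sums: "0 \<in> digit_sum w S ` digits S" if "S \<subseteq> primepow_factors R"
proof
  show "0 = digit_sum w S (\<lambda>s\<in>S. 0)" by (simp add: digit_sum_def)
  show "(\<lambda>s\<in>S. 0) \<in> digits S"
    using that by (auto simp: primepow_factors_def intro!: aprimedivisor_pos_primepow)
qed

lemma weight_in_digit_sums:
  assumes "S \<subseteq> primepow_factors R" "finite S" "s \<in> S"
  shows "w s \<in> digit_sum w S ` digits S"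
proof
  have *: "0 < aprimedivisor t" if "t \<in> S" for t
    using that assms by (auto simp: primepow_factors_def intro!: aprimedivisor_pos_primepow)
  have "1 < aprimedivisor s"
    using assms primepow_gt_Suc_0[of s] by (auto simp: primepow_factors_def)
  with * show "(\<lambda>t\<in>S. if t = s then 1 else 0) \<in> digits S" by auto
  have "digit_sum w S (\<lambda>t\<in>S. if t = s then 1 else 0) = (\<Sum>t\<in>S. if t = s then w t else 0)"
    unfolding digit_sum_def by (intro sum.cong) auto
  thus "w s = digit_sum w S (\<lambda>t\<in>S. if t = s then 1 else 0)"
    using assms by (simp add: sum.delta)
qed

lemma digits_empty_sums: "digit_sum w {} ` digits {} = {0}"
  by (simp add: digit_sum_def)

theorem theorem1p11:
  fixes B :: "nat set" and R :: nat
  assumes "finite B"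
    and "0 \<in> B"
    and "Gcd B = 1"
    and "coven_meyerowitz B"
    and "R = Lcm (cyclotomic_prime_powers B)"
  shows "\<exists>B' L L' :: nat set.
    finite B' \<and> finite L \<and> finite L' \<and>
    complementary_hadamard_pairs R (int ` B) (int ` L) (int ` B') (int ` L') \<and>
    coven_meyerowitz B'"
proof -

  \<comment> \<open>Cardinality of \<open>B\<close> and the prime powers dividing
    \<open>R\<close>\<close>
  define S where "S = cyclotomic_prime_powers B"
  have card_B: "int (card B) = (\<Prod>s\<in>S. poly (cyclotomic s) 1)"
    using assms(4) by (simp add: coven_meyerowitz_def CM_T1_def S_def poly_mask_poly_1)
  have "card B \<noteq> 1"
  proof
    assume "card B = 1"
    hence "B = {0}" using assms(2) by (auto simp: card_1_singleton_iff)
    thus False using assms(3) by simp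
  qed
  \<comment> \<open>Empty products and products over infinite sets are both 1, so
    \<open>card B \<noteq> 1\<close> gives nonemptiness and finiteness together.\<close>
  with card_B have S_ne: "S \<noteq> {}" and fin_S: "finite S"
    by (auto intro: ccontr)
  have primepow_S: "primepow s" if "s \<in> S" for s
    using that by (simp add: S_def cyclotomic_prime_powers_def)
  have R: "R > 0"
    using fin_S primepow_S[of 0] assms(5) by (auto simp: S_def[symmetric] Lcm_0_iff intro!: Nat.gr0I)
  define T where "T = primepow_factors R"
  have fin_T: "finite T" using R finite_primepow_factors[of R] by (simp add: T_def)
  have ST: "S \<subseteq> primepow_factors R"
    using primepow_S assms(5) by (auto simp: primepow_factors_def S_def[symmetric])
  define S' where "S' = T - S"
  have S'T: "S' \<subseteq> primepow_factors R" and fin_S': "finite S'"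
    using fin_T by (auto simp: S'_def T_def)
  have R2: "R \<ge> 2"
  proof -
    obtain s where s: "s \<in> S" using S_ne by blast
    hence "s dvd R" using ST by (auto simp: primepow_factors_def)
    hence "s \<le> R" using R by (rule dvd_imp_le)
    thus ?thesis using primepow_gt_Suc_0[OF primepow_S[OF s]] by simp
  qed
  have card_B': "card B = (\<Prod>s\<in>S. aprimedivisor s)"
  proof -
    have "int (card B) = (\<Prod>s\<in>S. int (aprimedivisor s))"
      unfolding card_B using primepow_S by (intro prod.cong) (auto simp: poly_cyclotomic_1)
    thus ?thesis by (metis of_nat_eq_iff of_nat_prod)
  qed
  have prod_T: "(\<Prod>s\<in>S. aprimedivisor s) * (\<Prod>s\<in>S'. aprimedivisor s) = R"
    using prod_aprimedivisor_primepow_factors[OF R] ST fin_T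
      prod.subset_diff[of S T aprimedivisor] by (simp add: S'_def T_def mult.commute)

  \<comment> \<open>The complement and the spectra\<close>
  define w where "w = cofactor_weight R"
  define B' where "B' = digit_sum w S' ` digits S'"
  define L where "L = digit_sum ((div) R) S ` digits S"
  define L' where "L' = digit_sum ((div) R) S' ` digits S'"

  \<comment> \<open>Vanishing of the exponential sums\<close>
  have T2: "(\<Sum>b\<in>B. unity_exp d (int b * j)) = 0"
    if d: "d > 1" "coprime j (int d)" "\<And>p. prime p \<Longrightarrow> p dvd d \<Longrightarrow> p ^ multiplicity p d \<in> S" for d j
  proof -
    have "prime_factors d \<noteq> {}"
      using d(1) by (auto simp: prime_factorization_empty_iff)
    hence "cyclotomic (\<Prod>p\<in>prime_factors d. p ^ multiplicity p d) dvd mask_poly B"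
      using assms(4) d(3) unfolding coven_meyerowitz_def CM_T2_def S_def
      by (auto simp: in_prime_factors_iff)
    hence "cyclotomic d dvd mask_poly B"
      using d(1) by (simp add: prime_factorization_nat[symmetric])
    thus ?thesis using d by (simp add: cyclotomic_dvd_mask_poly_iff)
  qed
  have van_B: "vanishing R S B int"
    unfolding vanishing_def using T2 by blast
  have van_B': "vanishing R S' (digits S') (\<lambda>c. int (digit_sum w S' c))"
    unfolding vanishing_def
  proof (intro allI impI, elim conjE)
    fix d j assume d: "d dvd R" "1 < d" "coprime j (int d)"
      and S': "\<forall>p. prime p \<and> p dvd d \<longrightarrow> p ^ multiplicity p d \<in> S'"
    obtain p where "prime p" "p dvd d" using d(2) prime_factor_nat[of d] by auto
    thus "(\<Sum>c\<in>digits S'. unity_exp d (int (digit_sum w S' c) * j)) = 0"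
      unfolding w_def using S' by (intro digits_sum_vanishes[OF R S'T d(1,3)]) auto
  qed
  \<comment> \<open>The sum factors. If all exact prime powers of \<open>d\<close> lie in
    \<open>S\<close>, the factor of \<open>B\<close> vanishes by (T2); otherwise one lies in
    \<open>S'\<close> and the other factor vanishes.\<close>
  have van_BB': "vanishing R T (B \<times> digits S') (\<lambda>(b, c). int b + int (digit_sum w S' c))"
    unfolding vanishing_def
  proof (intro allI impI, elim conjE)
    fix d j assume d: "d dvd R" "1 < d" "coprime j (int d)"
      and T: "\<forall>p. prime p \<and> p dvd d \<longrightarrow> p ^ multiplicity p d \<in> T"
    have "(\<Sum>i\<in>B \<times> digits S'. unity_exp d ((case i of (b, c) \<Rightarrow> int b + int (digit_sum w S' c)) * j)) =
        (\<Sum>b\<in>B. unity_exp d (int b * j)) * (\<Sum>c\<in>digits S'. unity_exp d (int (digit_sum w S' c) * j))"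
      by (simp add: sum_product sum.cartesian_product case_prod_unfold distrib_right unity_exp_add)
    also have "\<dots> = 0"
    proof (cases "\<forall>p. prime p \<and> p dvd d \<longrightarrow> p ^ multiplicity p d \<in> S")
      case True
      thus ?thesis using T2[OF d(2,3)] by simp
    next
      case False
      then obtain p where "prime p" "p dvd d" "p ^ multiplicity p d \<in> S'"
        using T by (auto simp: S'_def)
      thus ?thesis using digits_sum_vanishes[OF R S'T d(1,3)] by (simp add: w_def)
    qed
    finally show "(\<Sum>i\<in>B \<times> digits S'.
        unity_exp d ((case i of (b, c) \<Rightarrow> int b + int (digit_sum w S' c)) * j)) = 0" .
  qed

  \<comment> \<open>Incongruence of the sums\<close>
  have digits_ne: "digits S' \<noteq> {}"
    using zero_in_digit_sums[OF S'T] by auto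
  have card_prod: "card (B \<times> digits S') = (\<Prod>s\<in>T. aprimedivisor s)"
    using prod_T prod_aprimedivisor_primepow_factors[OF R] fin_S'
    by (simp add: card_cartesian_product card_B' card_digits T_def)
  have "unitary_on (B \<times> digits S') (digits T) (\<lambda>i c. unity_exp R ((case i of (b, c) \<Rightarrow>
      int b + int (digit_sum w S' c)) * int (digit_sum ((div) R) T c)) / sqrt (card (B \<times> digits S')))"
    by (rule vanishing_unitary_on[OF R _ _ _ card_prod van_BB'])
      (use assms(1,2) digits_ne fin_S' in \<open>auto simp: T_def finite_digits\<close>)
  from unitary_on_unity_exp_rows_incongruent[OF this]
  have incong: "b = b' \<and> c = c'"
    if "b \<in> B" "b' \<in> B" "c \<in> digits S'" "c' \<in> digits S'"
      "int R dvd (int b + int (digit_sum w S' c)) - (int b' + int (digit_sum w S' c'))" for b b' c c'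
    using that assms(1) R fin_S' fin_T card_prod by (force simp: finite_digits card_digits)
  \<comment> \<open>Taking \<open>0\<close> as both elements of \<open>B\<close> isolates the digit
    sums.\<close>
  have inj_B': "inj_on (\<lambda>c. int (digit_sum w S' c)) (digits S')"
  proof (rule inj_onI)
    fix c c' assume "c \<in> digits S'" "c' \<in> digits S'" "int (digit_sum w S' c) = int (digit_sum w S' c')"
    thus "c = c'" using incong[of 0 0 c c'] assms(2) by simp
  qed
  hence inj_B'_nat: "inj_on (digit_sum w S') (digits S')"
    by (auto simp: inj_on_def)

  \<comment> \<open>The two Hadamard pairs\<close>
  have hadamard_B: "hadamard_pair R (int ` B) (int ` L)"
    unfolding L_def image_image
  proof (rule hadamard_pairI[OF R2])
    show "unitary_on B (digits S)
        (\<lambda>i c. unity_exp R (int i * int (digit_sum ((div) R) S c)) / sqrt (card B))"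
      using assms(1,2) by (intro vanishing_unitary_on[OF R ST _ _ card_B' van_B]) auto
    show "0 \<in> (\<lambda>c. int (digit_sum ((div) R) S c)) ` digits S"
      using zero_in_digit_sums[OF ST, of "(div) R"] by (force simp: image_iff)
  qed (use assms(1,2) fin_S digit_sum_inj_on[OF R ST] in
      \<open>auto simp: finite_digits card_digits card_B'\<close>)
  have hadamard_B': "hadamard_pair R (int ` B') (int ` L')"
    unfolding B'_def L'_def image_image
  proof (rule hadamard_pairI[OF R2])
    show "unitary_on (digits S') (digits S')
        (\<lambda>i c. unity_exp R (int (digit_sum w S' i) * int (digit_sum ((div) R) S' c)) /
          sqrt (card (digits S')))"
      using digits_ne fin_S'
      by (intro vanishing_unitary_on[OF R S'T _ _ _ van_B']) (auto simp: finite_digits card_digits)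
    show "0 \<in> (\<lambda>c. int (digit_sum ((div) R) S' c)) ` digits S'"
      using zero_in_digit_sums[OF S'T, of "(div) R"] by (force simp: image_iff)
    show "0 \<in> (\<lambda>c. int (digit_sum w S' c)) ` digits S'"
      using zero_in_digit_sums[OF S'T, of w] by (force simp: image_iff)
  qed (use fin_S' digit_sum_inj_on[OF R S'T] inj_B' in \<open>auto simp: finite_digits card_digits\<close>)

  have fins: "finite B'" "finite L" "finite L'"
    using fin_S fin_S' by (simp_all add: B'_def L_def L'_def finite_digits)
  have cards: "card (int ` B) = (\<Prod>s\<in>S. aprimedivisor s)" "card (int ` L) = (\<Prod>s\<in>S. aprimedivisor s)"
    "card (int ` B') = (\<Prod>s\<in>S'. aprimedivisor s)" "card (int ` L') = (\<Prod>s\<in>S'. aprimedivisor s)"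
    unfolding B'_def L_def L'_def image_image
    using fin_S fin_S' digit_sum_inj_on[OF R ST] digit_sum_inj_on[OF R S'T] inj_B'
    by (simp_all add: card_image card_B' card_digits)
  have nes: "B' \<noteq> {}" "L \<noteq> {}" "L' \<noteq> {}"
    using zero_in_digit_sums[OF ST] zero_in_digit_sums[OF S'T]
    unfolding B'_def L_def L'_def by blast+

  \<comment> \<open>Complete residue systems\<close>
  have BB': "disjoint_differences (int ` B) (int ` B')" "complete_residues R (sumset (int ` B) (int ` B'))"
  proof -
    have "a = b \<and> a' = b'"
      if "a \<in> int ` B" "b \<in> int ` B" "a' \<in> int ` B'" "b' \<in> int ` B'" "int R dvd (a + a') - (b + b')"
      for a b a' b'
    proof -
      from that obtain k l c c' where "a = int k" "b = int l" "k \<in> B" "l \<in> B"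
        "c \<in> digits S'" "c' \<in> digits S'" "a' = int (digit_sum w S' c)" "b' = int (digit_sum w S' c')"
        by (auto simp: B'_def)
      with that(5) incong[of k l c c'] show ?thesis by simp
    qed
    from sumset_complete_residues[of "int ` B" "int ` B'" R, OF _ _ _ _ R _ this]
    show "disjoint_differences (int ` B) (int ` B')" "complete_residues R (sumset (int ` B) (int ` B'))"
      using assms(1,2) fins nes prod_T[folded cards(1,3)] by blast+
  qed

  have LL': "disjoint_differences (int ` L) (int ` L')" "complete_residues R (sumset (int ` L) (int ` L'))"
  proof -
    \<comment> \<open>As \<open>S\<close> and \<open>S'\<close> partition \<open>T\<close>, a pair
      of digit functions is one digit function on \<open>T\<close>, and uniqueness of digits modulo
      \<open>R\<close> applies.\<close>
    have merge: "digit_sum v S c + digit_sum v S' c' = digit_sum v T (\<lambda>s. if s \<in> S then c s else c' s)"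
      for v c c'
      unfolding digit_sum_def using ST fin_T
      by (subst sum.subset_diff[where A = T and B = S]) (auto simp: S'_def T_def add.commute)
    have "a = b \<and> a' = b'"
      if "a \<in> int ` L" "b \<in> int ` L" "a' \<in> int ` L'" "b' \<in> int ` L'" "int R dvd (a + a') - (b + b')"
      for a b a' b'
    proof -
      from that obtain c d c' d' where c: "c \<in> digits S" "d \<in> digits S" "c' \<in> digits S'" "d' \<in> digits S'"
        and ab: "a = int (digit_sum ((div) R) S c)" "b = int (digit_sum ((div) R) S d)"
          "a' = int (digit_sum ((div) R) S' c')" "b' = int (digit_sum ((div) R) S' d')"
        by (auto simp: L_def L'_def)
      define e where "e = (\<lambda>s. if s \<in> S then c s else c' s)"
      define f where "f = (\<lambda>s. if s \<in> S then d s else d' s)"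
      have "a + a' = int (digit_sum ((div) R) T e)" "b + b' = int (digit_sum ((div) R) T f)"
        by (simp_all add: ab e_def f_def merge[symmetric])
      hence dvd: "int R dvd int (digit_sum ((div) R) T e) - int (digit_sum ((div) R) T f)"
        using that(5) by simp
      have ef: "e s = f s" if "s \<in> T" for s
      proof (rule digit_sum_incongruent[OF R _ _ _ dvd that])
        show "T \<subseteq> primepow_factors R" by (simp add: T_def)
        show "e s < aprimedivisor s" "f s < aprimedivisor s" if "s \<in> T" for s
          using c that by (auto simp: e_def f_def S'_def PiE_iff)
      qed
      have "c = d"
        by (rule digits_eqI[OF c(1,2)]) (use ef ST in \<open>force simp: e_def f_def T_def\<close>)
      moreover have "c' = d'"
        by (rule digits_eqI[OF c(3,4)]) (use ef in \<open>force simp: e_def f_def S'_def\<close>)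
      ultimately show ?thesis using ab by simp
    qed
    from sumset_complete_residues[of "int ` L" "int ` L'" R, OF _ _ _ _ R _ this]
    show "disjoint_differences (int ` L) (int ` L')" "complete_residues R (sumset (int ` L) (int ` L'))"
      using fins nes prod_T[folded cards(2,4)] by blast+
  qed

  \<comment> \<open>Greatest common divisor and extreme cycles\<close>
  have zero_B': "0 \<in> B'" unfolding B'_def by (rule zero_in_digit_sums[OF S'T])
  have "Gcd (sumset (int ` B) (int ` B')) = 1"
  proof -
    have "Gcd (sumset (int ` B) (int ` B')) dvd Gcd (int ` B)"
    proof (rule Gcd_greatest)
      fix b assume "b \<in> int ` B"
      hence "b + int 0 \<in> sumset (int ` B) (int ` B')"
        using zero_B' unfolding sumset_def by blast
      thus "Gcd (sumset (int ` B) (int ` B')) dvd b" by (simp add: Gcd_dvd)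
    qed
    also have "Gcd (int ` B) = 1" using assms(3) by (simp add: Gcd_int_eq)
    finally show ?thesis by simp
  qed
  moreover have "C \<subseteq> \<int>" if "extreme_cycle R (int ` B) (int ` L) C" for C
    using that assms(1-3) R by (intro extreme_cycle_Ints[of B R "int ` L"]) auto
  moreover have "C \<subseteq> \<int>" if C: "extreme_cycle R (int ` B') (int ` L') C" for C
  proof (cases "S' = {}")
    case True
    have "int ` L' = {0}" unfolding L'_def True digits_empty_sums by simp
    thus ?thesis using C is_cycle_zero[of R C] R2 by (auto simp: extreme_cycle_def)
  next
    case False
    then obtain s where s: "s \<in> S'" by blast
    \<comment> \<open>The weight itself belongs to \<open>B'\<close>, as the digit sum with single
      digit 1 at \<open>s\<close>.\<close>
    have "Gcd B' dvd w s"
      unfolding B'_def using weight_in_digit_sums[OF S'T fin_S' s] by (rule Gcd_dvd)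
    also have "w s dvd R"
      unfolding w_def using s S'T by (intro cofactor_weight_dvd[OF R]) auto
    finally show ?thesis
      using C fins(1) zero_B' R by (intro extreme_cycle_Ints[of B' R "int ` L'"]) auto
  qed
  ultimately have "complementary_hadamard_pairs R (int ` B) (int ` L) (int ` B') (int ` L')"
    unfolding complementary_hadamard_pairs_def
    using hadamard_B hadamard_B' BB' LL' by blast
  moreover have "coven_meyerowitz B'"
    unfolding B'_def w_def by (rule coven_meyerowitz_digits[OF R S'T inj_B'_nat[unfolded w_def]])
  ultimately show ?thesis using fins by blast
qed

end
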